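(* Let $W$ be a group and $S\subseteq W$. Then $(W,S)$ is a right-angled Coxeter system if and only if $(W,S)$ is a reflection system with a reflection cocycle $N:W\to\mathcal{P}(T)$ (where $T=\bigcup_{g\in W}gSg^{-1}$) satisfying the meet intersection condition: for all $x,y\in W$, there is a unique $z\in W$ such that $N(z)=N(x)\cap N(y)$.
   Context: A right-angled Coxeter matrix on a set $S$ is a function $m:S\times S\to\mathbb{N}\cup\{\infty\}$ with $m(r,s)=m(s,r)$, $m(r,s)=1$ if and only if $r=s$, and $m(r,s)\in\{2,\infty\}$ for $r\neq s$. A right-angled Coxeter system is a pair $(W,S)$ where $W$ is a group, $S\subseteq W$, and $W\cong\langle s\in S\mid (rs)^{m(r,s)}=1 \text{ for all } r,s\in S\rangle$ (via the identity on $S$) for a right-angled Coxeter matrix $m$, relations with $m(r,s)=\infty$ being omitted. $S$ is not assumed finite. A reflection system is a pair $(G,R)$ where $G$ is a group and $R$ is a set of non-identity involutions (elements $r\neq 1$ with $r^2=1$) that generates $G$. For a reflection system put $T=\bigcup_{g\in G}gRg^{-1}$, and let $\mathcal{P}(T)$ denote its power set. A reflection cocycle for $(G,R)$ is a function $N:G\to\mathcal{P}(T)$ such that (1) $N(r)=\{r\}$ for all $r\in R$; and (2) $N(xy)=N(x)\,\Delta\,xN(y)x^{-1}$ for all $x,y\in G$, where $\Delta$ denotes symmetric difference of sets. *)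

theory Defs
  imports "HOL-Algebra.Generated_Groups" "HOL-Library.Extended_Nat"
begin

section \<open>Group presentations\<close>

text \<open>A letter \<open>(s, True)\<close> stands for the generator \<open>s\<close>, and \<open>(s, False)\<close> for its formal inverse.
  The group presented by generators \<open>S\<close> and relators \<open>R\<close> consists of the words in these letters
  modulo the congruence generated by free cancellation and \<open>r = 1\<close> for \<open>r \<in> R\<close>.\<close>

type_synonym 'a gword = "('a \<times> bool) list"

definition gwords :: "'a set \<Rightarrow> 'a gword set" where
  "gwords S = lists (S \<times> UNIV)"

inductive_set presentation_rel :: "'a set \<Rightarrow> 'a gword set \<Rightarrow> ('a gword \<times> 'a gword) set"
  for S :: "'a set" and R :: "'a gword set" where
  cancel: "\<lbrakk>u \<in> gwords S; v \<in> gwords S; s \<in> S\<rbrakk>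
    \<Longrightarrow> (u @ [(s, b), (s, \<not> b)] @ v, u @ v) \<in> presentation_rel S R"
| relator: "\<lbrakk>u \<in> gwords S; v \<in> gwords S; r \<in> R; r \<in> gwords S\<rbrakk>
    \<Longrightarrow> (u @ r @ v, u @ v) \<in> presentation_rel S R"
| refl: "u \<in> gwords S \<Longrightarrow> (u, u) \<in> presentation_rel S R"
| sym: "(u, v) \<in> presentation_rel S R \<Longrightarrow> (v, u) \<in> presentation_rel S R"
| trans: "\<lbrakk>(u, v) \<in> presentation_rel S R; (v, w) \<in> presentation_rel S R\<rbrakk>
    \<Longrightarrow> (u, w) \<in> presentation_rel S R"

definition word_class :: "'a set \<Rightarrow> 'a gword set \<Rightarrow> 'a gword \<Rightarrow> 'a gword set" where
  "word_class S R w = presentation_rel S R `` {w}"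

definition presented_group :: "'a set \<Rightarrow> 'a gword set \<Rightarrow> 'a gword set monoid" where
  "presented_group S R =
    \<lparr> carrier = gwords S // presentation_rel S R,
      mult = (\<lambda>A B. \<Union>u\<in>A. \<Union>v\<in>B. word_class S R (u @ v)),
      one = word_class S R [] \<rparr>"


section \<open>Right-angled Coxeter systems\<close>

definition right_angled_coxeter_matrix :: "'a set \<Rightarrow> ('a \<Rightarrow> 'a \<Rightarrow> enat) \<Rightarrow> bool" where
  "right_angled_coxeter_matrix S m \<longleftrightarrow>
    (\<forall>r\<in>S. \<forall>s\<in>S. m r s = m s r \<and> (m r s = 1 \<longleftrightarrow> r = s) \<and>
       (r \<noteq> s \<longrightarrow> m r s = 2 \<or> m r s = \<infinity>))"

definition coxeter_relators :: "'a set \<Rightarrow> ('a \<Rightarrow> 'a \<Rightarrow> enat) \<Rightarrow> 'a gword set" where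
  "coxeter_relators S m =
    {concat (replicate k [(r, True), (s, True)]) | r s k. r \<in> S \<and> s \<in> S \<and> m r s = enat k}"

definition right_angled_coxeter_system :: "('a, 'b) monoid_scheme \<Rightarrow> 'a set \<Rightarrow> bool" where
  "right_angled_coxeter_system W S \<longleftrightarrow>
    group W \<and> S \<subseteq> carrier W \<and>
    (\<exists>m. right_angled_coxeter_matrix S m \<and>
      (\<exists>\<phi> \<in> iso (presented_group S (coxeter_relators S m)) W.
        \<forall>s\<in>S. \<phi> (word_class S (coxeter_relators S m) [(s, True)]) = s))"


section \<open>Reflection systems and reflection cocycles\<close>

definition reflection_system :: "('a, 'b) monoid_scheme \<Rightarrow> 'a set \<Rightarrow> bool" where
  "reflection_system G R \<longleftrightarrow>
    group G \<and> R \<subseteq> carrier G \<and>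
    (\<forall>r\<in>R. r \<noteq> \<one>\<^bsub>G\<^esub> \<and> r \<otimes>\<^bsub>G\<^esub> r = \<one>\<^bsub>G\<^esub>) \<and>
    generate G R = carrier G"

definition conj_set :: "('a, 'b) monoid_scheme \<Rightarrow> 'a \<Rightarrow> 'a set \<Rightarrow> 'a set" where
  "conj_set G g A = (\<lambda>a. g \<otimes>\<^bsub>G\<^esub> a \<otimes>\<^bsub>G\<^esub> inv\<^bsub>G\<^esub> g) ` A"

definition reflections :: "('a, 'b) monoid_scheme \<Rightarrow> 'a set \<Rightarrow> 'a set" where
  "reflections G R = (\<Union>g\<in>carrier G. conj_set G g R)"

definition reflection_cocycle ::
    "('a, 'b) monoid_scheme \<Rightarrow> 'a set \<Rightarrow> ('a \<Rightarrow> 'a set) \<Rightarrow> bool" where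
  "reflection_cocycle G R N \<longleftrightarrow>
    N \<in> carrier G \<rightarrow> Pow (reflections G R) \<and>
    (\<forall>r\<in>R. N r = {r}) \<and>
    (\<forall>x\<in>carrier G. \<forall>y\<in>carrier G.
       N (x \<otimes>\<^bsub>G\<^esub> y) = sym_diff (N x) (conj_set G x (N y)))"

definition meet_intersection_condition ::
    "('a, 'b) monoid_scheme \<Rightarrow> ('a \<Rightarrow> 'a set) \<Rightarrow> bool" where
  "meet_intersection_condition G N \<longleftrightarrow>
    (\<forall>x\<in>carrier G. \<forall>y\<in>carrier G. \<exists>!z. z \<in> carrier G \<and> N z = N x \<inter> N y)"

end

theory Submission
  imports Defs
begin

text \<open>Any reflection cocycle \<open>N\<close> computes the inversion set of an element from a word: if the
  conjugates \<open>w\<^sub>i r\<^sub>i w\<^sub>i\<inverse>\<close> along a word, with \<open>w\<^sub>i\<close> the prefix of length \<open>i - 1\<close>, are distinct,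
  they make up \<open>N\<close>, and otherwise two letters can be deleted. Being right-angled is equivalent to
  the following condition on descents: if \<open>a, s \<in> S\<close> both lie in \<open>N x\<close>, then \<open>a s = s a\<close>. Under
  this condition \<open>a u = u b\<close> with \<open>u b\<close> reduced forces \<open>a = b\<close> and \<open>a\<close> to commute with every letter
  of \<open>u\<close>, so that words are reduced by commutations and deletions of squares only; this gives the
  right-angled presentation.

  The meet condition implies the descent condition because \<open>N (s x) \<inter> N (s a) = {s a s}\<close>, which is
  some \<open>N z\<close> only if \<open>s a s \<in> S\<close>, and then the cocycle identity forces \<open>a\<close> and \<open>s\<close> to commute.
  Conversely, in a right-angled Coxeter system a non-commuting pair generates an infinite dihedral
  group, which is detected by its ping-pong action on the integers, and which has no element with
  both descents. For meets, the minimal \<open>g\<close> with \<open>t \<in> N g \<subseteq> N x\<close> depends only on the reflection \<open>t\<close>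
  and not on \<open>x\<close>, so if \<open>N x\<close> and \<open>N y\<close> meet, then they already meet in \<open>S\<close>; hence a maximal \<open>z\<close>
  with \<open>N z \<subseteq> N x \<inter> N y\<close> has \<open>N z = N x \<inter> N y\<close>.\<close>

section \<open>Group presentations\<close>

lemma gwords_Nil [simp]: "[] \<in> gwords S"
  and gwords_Cons [simp]: "l # w \<in> gwords S \<longleftrightarrow> fst l \<in> S \<and> w \<in> gwords S"
  and gwords_append [simp]: "u @ v \<in> gwords S \<longleftrightarrow> u \<in> gwords S \<and> v \<in> gwords S"
  by (cases l) (auto simp: gwords_def mem_Times_iff)

lemma presentation_rel_gwords:
  assumes "(u, v) \<in> presentation_rel S R"
  shows "u \<in> gwords S \<and> v \<in> gwords S"
  using assms by induction auto

lemma presentation_rel_context: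
  assumes "(u, v) \<in> presentation_rel S R" "p \<in> gwords S" "q \<in> gwords S"
  shows "(p @ u @ q, p @ v @ q) \<in> presentation_rel S R"
  using assms
proof induction
  case (cancel u v s b)
  then show ?case
    using presentation_rel.cancel[of "p @ u" S "v @ q" s b R] by simp
next
  case (relator u v r)
  then show ?case
    using presentation_rel.relator[of "p @ u" S "v @ q" r R] by simp
qed (auto intro: presentation_rel.refl presentation_rel.sym presentation_rel.trans)

lemma presentation_rel_append:
  assumes "(u, u') \<in> presentation_rel S R" "(v, v') \<in> presentation_rel S R"
  shows "(u @ v, u' @ v') \<in> presentation_rel S R"
proof (rule presentation_rel.trans)
  show "(u @ v, u' @ v) \<in> presentation_rel S R"
    using presentation_rel_context[OF assms(1), of "[]" v] presentation_rel_gwords[OF assms(2)]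
    by simp
  show "(u' @ v, u' @ v') \<in> presentation_rel S R"
    using presentation_rel_context[OF assms(2), of u' "[]"] presentation_rel_gwords[OF assms(1)]
    by simp
qed

lemma equiv_presentation_rel: "equiv (gwords S) (presentation_rel S R)"
proof (rule equivI)
  show "presentation_rel S R \<subseteq> gwords S \<times> gwords S"
    using presentation_rel_gwords by auto
  show "refl_on (gwords S) (presentation_rel S R)"
    by (auto intro!: refl_onI presentation_rel.refl)
  show "sym (presentation_rel S R)"
    by (auto intro!: symI presentation_rel.sym)
  show "trans (presentation_rel S R)"
    by (auto intro!: transI intro: presentation_rel.trans)
qed

lemma word_class_eq_iff:
  assumes "u \<in> gwords S" "v \<in> gwords S"
  shows "word_class S R u = word_class S R v \<longleftrightarrow> (u, v) \<in> presentation_rel S R"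
  unfolding word_class_def using eq_equiv_class_iff[OF equiv_presentation_rel assms] .

lemma word_class_self: "w \<in> gwords S \<Longrightarrow> w \<in> word_class S R w"
  by (auto simp: word_class_def intro: presentation_rel.refl)

lemma carrier_presented_group:
  "carrier (presented_group S R) = word_class S R ` gwords S"
  by (auto simp: presented_group_def quotient_def word_class_def)

lemma mult_presented_group:
  assumes "u \<in> gwords S" "v \<in> gwords S"
  shows "word_class S R u \<otimes>\<^bsub>presented_group S R\<^esub> word_class S R v = word_class S R (u @ v)"
proof -
  have eq: "word_class S R (u' @ v') = word_class S R (u @ v)"
    if "u' \<in> word_class S R u" "v' \<in> word_class S R v" for u' v'
  proof -
    have uv: "(u, u') \<in> presentation_rel S R" "(v, v') \<in> presentation_rel S R"
      using that by (auto simp: word_class_def)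
    from presentation_rel_append[OF this] show ?thesis
      using word_class_eq_iff[of "u @ v" S "u' @ v'" R] assms
        uv[THEN presentation_rel_gwords] by auto
  qed
  have "(\<Union>u'\<in>word_class S R u. \<Union>v'\<in>word_class S R v. word_class S R (u' @ v')) =
      (\<Union>u'\<in>word_class S R u. \<Union>v'\<in>word_class S R v. word_class S R (u @ v))"
    by (intro SUP_cong[OF HOL.refl] eq)
  also have "\<dots> = word_class S R (u @ v)"
    using word_class_self[OF assms(1), of R] word_class_self[OF assms(2), of R] by auto
  finally show ?thesis by (simp add: presented_group_def)
qed

text \<open>The universal property in the form of an action: if opposite letters undo each other and
  relators act trivially on \<open>X\<close>, then congruent words act alike. The set
  \<open>X\<close> admits operations that behave well only on a part of their type.\<close>

lemma foldr_presentation_rel: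
  assumes "(u, v) \<in> presentation_rel S R" "x \<in> X"
    and closed: "\<And>l x. \<lbrakk>fst l \<in> S; x \<in> X\<rbrakk> \<Longrightarrow> h l x \<in> X"
    and cancel: "\<And>s b x. \<lbrakk>s \<in> S; x \<in> X\<rbrakk> \<Longrightarrow> h (s, b) (h (s, \<not> b) x) = x"
    and relator: "\<And>r x. \<lbrakk>r \<in> R; r \<in> gwords S; x \<in> X\<rbrakk> \<Longrightarrow> foldr h r x = x"
  shows "foldr h u x = foldr h v x"
proof -
  have foldr_closed: "foldr h w x \<in> X" if "w \<in> gwords S" "x \<in> X" for w x
    using that by (induction w) (auto intro: closed)
  show ?thesis
    using assms(1,2) by (induction arbitrary: x) (auto simp: cancel relator foldr_closed)
qed

section \<open>Evaluation of words and recognition of a presentation\<close>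

definition eval_gword :: "('a, 'b) monoid_scheme \<Rightarrow> 'a gword \<Rightarrow> 'a" where
  "eval_gword G w = foldr (\<lambda>(s, b) x. (if b then s else inv\<^bsub>G\<^esub> s) \<otimes>\<^bsub>G\<^esub> x) w \<one>\<^bsub>G\<^esub>"

context group
begin

lemma eval_gword_Nil [simp]: "eval_gword G [] = \<one>"
  and eval_gword_Cons [simp]:
    "eval_gword G ((s, b) # w) = (if b then s else inv s) \<otimes> eval_gword G w"
  by (auto simp: eval_gword_def)

lemma eval_gword_closed:
  "\<lbrakk>S \<subseteq> carrier G; w \<in> gwords S\<rbrakk> \<Longrightarrow> eval_gword G w \<in> carrier G"
  by (induction w) auto

lemma eval_gword_append:
  "\<lbrakk>S \<subseteq> carrier G; u \<in> gwords S; v \<in> gwords S\<rbrakk>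
    \<Longrightarrow> eval_gword G (u @ v) = eval_gword G u \<otimes> eval_gword G v"
  by (induction u) (auto simp: eval_gword_closed m_assoc subset_eq)

text \<open>An isomorphism that fixes the generators must send the class of a word to the value of
  the word, so its existence can be expressed through words and their values alone.\<close>

lemma iso_presented_group_iff:
  assumes S: "S \<subseteq> carrier G"
  shows "(\<exists>\<phi>\<in>iso (presented_group S R) G. \<forall>s\<in>S. \<phi> (word_class S R [(s, True)]) = s) \<longleftrightarrow>
    (\<forall>u\<in>gwords S. \<forall>v\<in>gwords S.
      (u, v) \<in> presentation_rel S R \<longleftrightarrow> eval_gword G u = eval_gword G v) \<and>
    eval_gword G ` gwords S = carrier G"
    (is "?L \<longleftrightarrow> ?R")
proof
  assume ?L
  then obtain \<phi> where iso: "\<phi> \<in> iso (presented_group S R) G"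
    and gen: "\<And>s. s \<in> S \<Longrightarrow> \<phi> (word_class S R [(s, True)]) = s"
    by auto
  let ?c = "word_class S R"
  have bij: "bij_betw \<phi> (?c ` gwords S) (carrier G)"
    using iso by (simp add: iso_def carrier_presented_group)
  have closed: "\<phi> (?c w) \<in> carrier G" if "w \<in> gwords S" for w
    using bij_betw_apply[OF bij] that by blast
  have mult: "\<phi> (?c (u @ v)) = \<phi> (?c u) \<otimes> \<phi> (?c v)"
    if "u \<in> gwords S" "v \<in> gwords S" for u v
  proof -
    have "\<phi> (?c u \<otimes>\<^bsub>presented_group S R\<^esub> ?c v) = \<phi> (?c u) \<otimes> \<phi> (?c v)"
      using iso that by (auto simp: iso_def hom_def carrier_presented_group)
    then show ?thesis using mult_presented_group[OF that, of R] by simp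
  qed
  have one: "\<phi> (?c []) = \<one>"
    using mult[of "[]" "[]"] closed[of "[]"] by simp
  have letter: "\<phi> (?c [(s, b)]) = (if b then s else inv s)" if "s \<in> S" for s b
  proof (cases b)
    case False
    have "?c [(s, True), (s, False)] = ?c []"
      using presentation_rel.cancel[of "[]" S "[]" s True R] that by (simp add: word_class_eq_iff)
    then have "\<one> = \<phi> (?c ([(s, True)] @ [(s, False)]))"
      by (simp add: one)
    also have "\<dots> = \<phi> (?c [(s, True)]) \<otimes> \<phi> (?c [(s, False)])"
      using that by (intro mult) simp_all
    also have "\<dots> = s \<otimes> \<phi> (?c [(s, False)])"
      by (simp only: gen[OF that])
    finally have "s \<otimes> \<phi> (?c [(s, False)]) = \<one>" by (rule HOL.sym)
    then have "inv s = \<phi> (?c [(s, False)])"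
      using closed[of "[(s, False)]"] that S by (intro inv_equality[OF inv_comm]) auto
    then show ?thesis using False by simp
  qed (simp add: gen that)
  have eval: "\<phi> (?c w) = eval_gword G w" if "w \<in> gwords S" for w
    using that
  proof (induction w)
    case (Cons l w)
    then show ?case
      using mult[of "[l]" w] letter[of "fst l" "snd l"] by (cases l) auto
  qed (simp add: one)
  show ?R
  proof (intro conjI ballI)
    fix u v assume uv: "u \<in> gwords S" "v \<in> gwords S"
    have "?c u = ?c v \<longleftrightarrow> \<phi> (?c u) = \<phi> (?c v)"
      using bij uv by (auto simp: bij_betw_def inj_on_def)
    then show "(u, v) \<in> presentation_rel S R \<longleftrightarrow> eval_gword G u = eval_gword G v"
      using uv by (simp add: eval word_class_eq_iff)
  next
    show "eval_gword G ` gwords S = carrier G"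
      using bij eval by (simp add: bij_betw_def image_image cong: image_cong_simp)
  qed
next
  assume R: ?R
  \<comment> \<open>The representative does not matter, as congruent words have equal
    values.\<close>
  define \<phi> where "\<phi> A = eval_gword G (SOME w. w \<in> A)" for A
  have \<phi>: "\<phi> (word_class S R w) = eval_gword G w" if "w \<in> gwords S" for w
  proof -
    have "(SOME v. v \<in> word_class S R w) \<in> word_class S R w"
      using word_class_self[OF that] by (rule someI)
    then have "(w, SOME v. v \<in> word_class S R w) \<in> presentation_rel S R"
      by (simp add: word_class_def)
    then show ?thesis
      using R presentation_rel_gwords by (metis \<phi>_def)
  qed
  show ?L
  proof (intro bexI ballI)
    fix s assume "s \<in> S"
    then show "\<phi> (word_class S R [(s, True)]) = s"
      using S by (auto simp: \<phi>)
  next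
    have "inj_on \<phi> (word_class S R ` gwords S)"
      using R by (auto simp: inj_on_def \<phi> word_class_eq_iff)
    moreover have "\<phi> ` word_class S R ` gwords S = carrier G"
      using R by (simp add: image_image \<phi> cong: image_cong_simp)
    ultimately show "\<phi> \<in> iso (presented_group S R) G"
      using S by (simp add: iso_def hom_def bij_betw_def Pi_iff carrier_presented_group
          mult_presented_group \<phi> eval_gword_append eval_gword_closed)
  qed
qed

end

section \<open>Words in involutions\<close>

context group
begin

definition conj_by :: "'a \<Rightarrow> 'a \<Rightarrow> 'a" where
  "conj_by g t = g \<otimes> t \<otimes> inv g"

definition wprod :: "'a list \<Rightarrow> 'a" where
  "wprod ws = foldr (\<otimes>) ws \<one>"

text \<open>Entry \<open>i\<close> is the \<open>i\<close>-th letter conjugated by the product of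
  the letters before it. Distinctness of this list serves as the notion of a reduced word, with no
  reference to a cocycle or a length function.\<close>

primrec inversions :: "'a list \<Rightarrow> 'a list" where
  "inversions [] = []"
| "inversions (r # ws) = r # map (conj_by r) (inversions ws)"

lemma conj_set_conv: "conj_set G g A = conj_by g ` A"
  by (simp add: conj_set_def conj_by_def)

lemma conj_by_closed [simp]:
  "\<lbrakk>g \<in> carrier G; t \<in> carrier G\<rbrakk> \<Longrightarrow> conj_by g t \<in> carrier G"
  by (simp add: conj_by_def)

lemma conj_by_one [simp]: "t \<in> carrier G \<Longrightarrow> conj_by \<one> t = t"
  by (simp add: conj_by_def)

lemma conj_by_mult:
  "\<lbrakk>g \<in> carrier G; h \<in> carrier G; t \<in> carrier G\<rbrakk>
    \<Longrightarrow> conj_by (g \<otimes> h) t = conj_by g (conj_by h t)"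
  by (simp add: conj_by_def inv_mult_group m_assoc)

lemma conj_by_eq_iff:
  "\<lbrakk>g \<in> carrier G; t \<in> carrier G; u \<in> carrier G\<rbrakk>
    \<Longrightarrow> conj_by g t = u \<longleftrightarrow> g \<otimes> t = u \<otimes> g"
  by (metis conj_by_def inv_solve_right m_closed)

lemma conj_by_inv_iff:
  "\<lbrakk>g \<in> carrier G; t \<in> carrier G; u \<in> carrier G\<rbrakk>
    \<Longrightarrow> conj_by (inv g) t = u \<longleftrightarrow> conj_by g u = t"
  by (metis conj_by_mult conj_by_one inv_closed l_inv r_inv)

lemma conj_by_inject:
  "\<lbrakk>g \<in> carrier G; t \<in> carrier G; u \<in> carrier G\<rbrakk>
    \<Longrightarrow> conj_by g t = conj_by g u \<longleftrightarrow> t = u"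
  by (metis conj_by_mult conj_by_one inv_closed l_inv)

lemma mem_conj_by_image:
  "\<lbrakk>g \<in> carrier G; t \<in> carrier G; A \<subseteq> carrier G\<rbrakk>
    \<Longrightarrow> t \<in> conj_by g ` A \<longleftrightarrow> conj_by (inv g) t \<in> A"
  by (smt (verit, best) conj_by_closed conj_by_inv_iff image_iff inv_closed subsetD)

lemma wprod_Nil [simp]: "wprod [] = \<one>"
  and wprod_Cons [simp]: "wprod (r # ws) = r \<otimes> wprod ws"
  by (simp_all add: wprod_def)

lemma length_inversions [simp]: "length (inversions ws) = length ws"
  by (induction ws) auto

end

text \<open>The setting shared by both directions. In a right-angled Coxeter system only the squares
  of the generators are known at first; that they differ from \<open>\<one>\<close> is read off
  later from the cocycle.\<close>

locale involution_generated = group G for G :: "('a, 'b) monoid_scheme" (structure) +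
  fixes S :: "'a set"
  assumes S_subset: "S \<subseteq> carrier G"
    and involution: "r \<in> S \<Longrightarrow> r \<otimes> r = \<one>"
    and generate_S: "generate G S = carrier G"
begin

lemma S_closed [simp]: "s \<in> S \<Longrightarrow> s \<in> carrier G"
  using S_subset by auto

lemma inv_S: "s \<in> S \<Longrightarrow> inv s = s"
  by (simp add: inv_equality involution)

lemma involution_cancel: "\<lbrakk>s \<in> S; x \<in> carrier G\<rbrakk> \<Longrightarrow> s \<otimes> (s \<otimes> x) = x"
  by (simp add: involution flip: m_assoc)

lemma conj_by_involution: "\<lbrakk>s \<in> S; t \<in> carrier G\<rbrakk> \<Longrightarrow> conj_by s (conj_by s t) = t"
  by (simp add: involution flip: conj_by_mult)

lemma conj_by_S_eq_iff: "\<lbrakk>s \<in> S; t \<in> carrier G\<rbrakk> \<Longrightarrow> conj_by s t = s \<longleftrightarrow> t = s"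
  by (simp add: conj_by_eq_iff)

lemma wprod_closed [simp]: "set ws \<subseteq> S \<Longrightarrow> wprod ws \<in> carrier G"
  by (induction ws) auto

lemma wprod_append:
  "\<lbrakk>set u \<subseteq> S; set v \<subseteq> S\<rbrakk> \<Longrightarrow> wprod (u @ v) = wprod u \<otimes> wprod v"
  by (induction u) (auto simp: m_assoc)

lemma wprod_rev: "set ws \<subseteq> S \<Longrightarrow> wprod (rev ws) = inv (wprod ws)"
  by (induction ws) (auto simp: wprod_append inv_mult_group inv_S)

lemma ex_word: "x \<in> carrier G \<Longrightarrow> \<exists>ws. set ws \<subseteq> S \<and> wprod ws = x"
proof -
  have "\<exists>ws. set ws \<subseteq> S \<and> wprod ws = x" if "x \<in> generate G S" for x
    using that
  proof induction
    case one
    then show ?case by (auto intro: exI[of _ "[]"])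
  next
    case (incl h)
    then show ?case by (auto intro!: exI[of _ "[h]"])
  next
    case (inv h)
    then show ?case by (auto intro!: exI[of _ "[h]"] simp: inv_S)
  next
    case (eng h1 h2)
    then show ?case by (metis Un_least set_append wprod_append)
  qed
  then show "x \<in> carrier G \<Longrightarrow> \<exists>ws. set ws \<subseteq> S \<and> wprod ws = x"
    by (simp add: generate_S)
qed

lemma inversions_closed:
  "\<lbrakk>set ws \<subseteq> S; t \<in> set (inversions ws)\<rbrakk> \<Longrightarrow> t \<in> carrier G"
  by (induction ws arbitrary: t) auto

lemma inversions_append:
  "\<lbrakk>set u \<subseteq> S; set v \<subseteq> S\<rbrakk>
    \<Longrightarrow> inversions (u @ v) = inversions u @ map (conj_by (wprod u)) (inversions v)"
  by (induction u) (auto simp: conj_by_mult inversions_closed intro!: map_idI[symmetric])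

lemma mem_inversions_iff:
  assumes "set ws \<subseteq> S"
  shows "t \<in> set (inversions ws) \<longleftrightarrow> (\<exists>u b v. ws = u @ b # v \<and> t = conj_by (wprod u) b)"
proof
  assume "t \<in> set (inversions ws)"
  with assms show "\<exists>u b v. ws = u @ b # v \<and> t = conj_by (wprod u) b"
  proof (induction ws arbitrary: t)
    case (Cons r ws)
    show ?case
    proof (cases "t = r")
      case True
      then show ?thesis using Cons.prems by (intro exI[of _ "[]"]) auto
    next
      case False
      then obtain t' where t': "t' \<in> set (inversions ws)" "t = conj_by r t'"
        using Cons.prems by auto
      then obtain u b v where "ws = u @ b # v" "t' = conj_by (wprod u) b"
        using Cons.IH[of t'] Cons.prems by auto
      then show ?thesis using Cons.prems t'(2)
        by (intro exI[of _ "r # u"]) (auto simp: conj_by_mult)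
    qed
  qed simp
qed (use assms in \<open>auto simp: inversions_append\<close>)

text \<open>Conjugation by \<open>r\<close> is injective and takes only \<open>r\<close> to
  \<open>r\<close>, so a new repetition must involve the leading \<open>r\<close>.\<close>

lemma distinct_inversions_Cons:
  assumes "r \<in> S" "set ws \<subseteq> S"
  shows "distinct (inversions (r # ws)) \<longleftrightarrow>
    distinct (inversions ws) \<and> r \<notin> set (inversions ws)"
proof -
  have "inj_on (conj_by r) (set (inversions ws))"
    using assms by (auto simp: inj_on_def conj_by_inject inversions_closed)
  moreover have "r \<in> conj_by r ` set (inversions ws) \<longleftrightarrow> r \<in> set (inversions ws)"
    using assms inversions_closed conj_by_S_eq_iff by (metis (no_types, lifting) S_closed image_iff)
  ultimately show ?thesis by (auto simp: distinct_map)
qed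

lemma distinct_inversions_prefix:
  "\<lbrakk>set u \<subseteq> S; set v \<subseteq> S; distinct (inversions (u @ v))\<rbrakk> \<Longrightarrow> distinct (inversions u)"
  by (simp add: inversions_append)

text \<open>Read from the right, let \<open>a\<close> be the first letter at which distinctness
  fails. Then \<open>a\<close> is an inversion \<open>conj_by (wprod u) b\<close> of the reduced
  word after it, which is the equation. That \<open>u @ [b]\<close> is reduced is kept for
  \<open>exchange_commute\<close>.\<close>

lemma not_distinct_inversions:
  assumes "set ws \<subseteq> S" "\<not> distinct (inversions ws)"
  shows "\<exists>p a u b v. ws = p @ a # u @ b # v \<and> a \<otimes> wprod u = wprod u \<otimes> b \<and>
    distinct (inversions (u @ [b]))"
  using assms
proof (induction ws)
  case (Cons r ws)
  show ?case
  proof (cases "distinct (inversions ws)")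
    case True
    then have "r \<in> set (inversions ws)"
      using Cons.prems distinct_inversions_Cons[of r ws] by auto
    then obtain u b v where uv: "ws = u @ b # v" "r = conj_by (wprod u) b"
      using Cons.prems mem_inversions_iff by auto
    moreover have "r \<otimes> wprod u = wprod u \<otimes> b"
      using uv Cons.prems conj_by_eq_iff[of "wprod u" b r] by auto
    moreover have "distinct (inversions (u @ [b]))"
      using uv Cons.prems True distinct_inversions_prefix[of "u @ [b]" v] by auto
    ultimately show ?thesis by (intro exI[of _ "[]"]) auto
  next
    case False
    then obtain p a u b v where "ws = p @ a # u @ b # v" "a \<otimes> wprod u = wprod u \<otimes> b"
      "distinct (inversions (u @ [b]))"
      using Cons by auto
    then show ?thesis by (intro exI[of _ "r # p"]) auto
  qed
qed simp

lemma conj_by_wprod_snoc: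
  "\<lbrakk>set u \<subseteq> S; c \<in> S\<rbrakk> \<Longrightarrow> conj_by (wprod (u @ [c])) c = conj_by (wprod u) c"
  by (simp add: wprod_append conj_by_mult conj_by_S_eq_iff[THEN iffD2])

text \<open>The deletion condition: with \<open>a\<close> moved across \<open>u\<close> it becomes
  \<open>b\<close> and cancels against the next \<open>b\<close>.\<close>

lemma shorten_word:
  assumes "set ws \<subseteq> S" "\<not> distinct (inversions ws)"
  shows "\<exists>p a u b v. ws = p @ a # u @ b # v \<and> wprod (p @ u @ v) = wprod ws"
proof -
  obtain p a u b v where ws: "ws = p @ a # u @ b # v" and eq: "a \<otimes> wprod u = wprod u \<otimes> b"
    using not_distinct_inversions[OF assms] by auto
  have "a \<otimes> (wprod u \<otimes> (b \<otimes> wprod v)) = (a \<otimes> wprod u) \<otimes> (b \<otimes> wprod v)"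
    using assms(1) ws by (simp add: m_assoc)
  also have "\<dots> = wprod u \<otimes> wprod v"
    using assms(1) ws by (simp add: eq m_assoc involution_cancel)
  finally show ?thesis
    using assms(1) ws
    by (intro exI[of _ p] exI[of _ a] exI[of _ u] exI[of _ b] exI[of _ v]) (simp add: wprod_append)
qed

text \<open>Deletions introduce no letters, so reducing a word in two generators keeps it in these
  two; the dihedral argument relies on this.\<close>

lemma ex_reduced_subset:
  assumes "set ws \<subseteq> S"
  shows "\<exists>ws'. set ws' \<subseteq> set ws \<and> wprod ws' = wprod ws \<and> distinct (inversions ws')"
  using assms
proof (induction ws rule: length_induct)
  case (1 ws)
  show ?case
  proof (cases "distinct (inversions ws)")
    case False
    then obtain p a u b v where ws: "ws = p @ a # u @ b # v" "wprod (p @ u @ v) = wprod ws"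
      using shorten_word 1 by blast
    have "\<exists>ws'. set ws' \<subseteq> set (p @ u @ v) \<and> wprod ws' = wprod (p @ u @ v) \<and>
        distinct (inversions ws')"
      using 1 ws(1) by (intro "1.IH"[rule_format]) auto
    then obtain ws' where "set ws' \<subseteq> set (p @ u @ v)" "wprod ws' = wprod (p @ u @ v)"
        "distinct (inversions ws')"
      by auto
    then show ?thesis using ws by (intro exI[of _ ws']) auto
  qed auto
qed

lemma ex_reduced:
  assumes "x \<in> carrier G"
  shows "\<exists>ws. set ws \<subseteq> S \<and> wprod ws = x \<and> distinct (inversions ws)"
proof -
  obtain ws where ws: "set ws \<subseteq> S" "wprod ws = x"
    using ex_word[OF assms] by auto
  obtain ws' where "set ws' \<subseteq> set ws" "wprod ws' = wprod ws" "distinct (inversions ws')"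
    using ex_reduced_subset[OF ws(1)] by auto
  with ws show ?thesis by (intro exI[of _ ws']) auto
qed

end

section \<open>Inversion sets given by a reflection cocycle\<close>

locale reflection_cocycle_group = involution_generated +
  fixes N :: "'a \<Rightarrow> 'a set"
  assumes cocycle: "reflection_cocycle G S N"
begin

lemma N_S: "r \<in> S \<Longrightarrow> N r = {r}"
  using cocycle by (simp add: reflection_cocycle_def)

lemma N_subset: "x \<in> carrier G \<Longrightarrow> N x \<subseteq> carrier G"
  using cocycle by (fastforce simp: reflection_cocycle_def reflections_def conj_set_conv)

lemma N_mult:
  "\<lbrakk>x \<in> carrier G; y \<in> carrier G\<rbrakk> \<Longrightarrow> N (x \<otimes> y) = sym_diff (N x) (conj_by x ` N y)"
  using cocycle by (simp add: reflection_cocycle_def conj_set_conv)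

lemma mem_N_mult:
  assumes "x \<in> carrier G" "y \<in> carrier G" "t \<in> carrier G"
  shows "t \<in> N (x \<otimes> y) \<longleftrightarrow> (t \<in> N x) \<noteq> (conj_by (inv x) t \<in> N y)"
  using mem_conj_by_image[OF assms(1,3) N_subset[OF assms(2)]] assms by (auto simp: N_mult)

lemma mem_N_S_mult:
  assumes "r \<in> S" "y \<in> carrier G" "t \<in> carrier G"
  shows "t \<in> N (r \<otimes> y) \<longleftrightarrow> (t = r) \<noteq> (conj_by r t \<in> N y)"
  using mem_N_mult[of r y t] assms by (simp add: N_S inv_S)

lemma N_mult_S:
  "\<lbrakk>x \<in> carrier G; r \<in> S\<rbrakk> \<Longrightarrow> N (x \<otimes> r) = sym_diff (N x) {conj_by x r}"
  by (simp add: N_mult N_S)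

lemma N_one [simp]: "N \<one> = {}"
proof -
  have "conj_by \<one> ` N \<one> = N \<one>"
    using N_subset[of \<one>] by (force simp: image_iff)
  then show ?thesis using N_mult[of \<one> \<one>] by auto
qed

lemma N_wprod_subset: "set ws \<subseteq> S \<Longrightarrow> N (wprod ws) \<subseteq> set (inversions ws)"
  by (induction ws) (auto simp: N_mult N_S)

text \<open>The cocycle identity makes \<open>N\<close> the repeated symmetric difference of the
  singletons of the inversions; when these are distinct, nothing cancels.\<close>

lemma N_wprod:
  "\<lbrakk>set ws \<subseteq> S; distinct (inversions ws)\<rbrakk> \<Longrightarrow> N (wprod ws) = set (inversions ws)"
proof (induction ws)
  case (Cons r ws)
  then have "N (wprod ws) = set (inversions ws)"
    using distinct_inversions_Cons by auto
  then show ?case using Cons.prems by (auto simp: N_mult N_S)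
qed simp

lemma finite_N: "x \<in> carrier G \<Longrightarrow> finite (N x)"
  using ex_word N_wprod_subset by (metis finite_set finite_subset)

lemma ex_reduced_N:
  assumes "x \<in> carrier G"
  shows "\<exists>ws. set ws \<subseteq> S \<and> wprod ws = x \<and> distinct (inversions ws) \<and> N x = set (inversions ws)"
  using ex_reduced[OF assms] N_wprod by metis

lemma N_eq_empty_iff: "x \<in> carrier G \<Longrightarrow> N x = {} \<longleftrightarrow> x = \<one>"
proof
  assume x: "x \<in> carrier G" "N x = {}"
  then obtain ws where "wprod ws = x" "set (inversions ws) = {}"
    using ex_reduced_N by metis
  then show "x = \<one>"
    by (metis length_inversions length_0_conv set_empty wprod_Nil)
qed simp

text \<open>Writing \<open>y\<close> as \<open>x \<otimes> (inv x \<otimes> y)\<close>, the cocycle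
  identity leaves \<open>N (inv x \<otimes> y)\<close> empty. This gives the uniqueness of
  meets.\<close>

lemma N_eqD:
  assumes "x \<in> carrier G" "y \<in> carrier G" "N x = N y"
  shows "x = y"
proof -
  have "N (x \<otimes> (inv x \<otimes> y)) = N x"
    using assms by (simp add: inv_solve_left flip: m_assoc)
  then have "conj_by x ` N (inv x \<otimes> y) = {}"
    using assms(1,2) by (auto simp: N_mult[of x "inv x \<otimes> y"])
  then have "inv x \<otimes> y = \<one>"
    using assms(1,2) N_eq_empty_iff by simp
  then show ?thesis
    using assms(1,2) by (metis inv_closed inv_equality inv_inv)
qed

lemma ex_N_S:
  assumes "x \<in> carrier G" "x \<noteq> \<one>"
  shows "\<exists>r\<in>S. r \<in> N x"
proof -
  obtain ws where ws: "set ws \<subseteq> S" "wprod ws = x" "N x = set (inversions ws)"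
    using ex_reduced_N[OF assms(1)] by auto
  then show ?thesis using assms(2) by (cases ws) auto
qed

end

section \<open>Commuting left descents and the exchange of letters\<close>

locale commuting_descents = reflection_cocycle_group +
  assumes descents_commute:
    "\<lbrakk>a \<in> S; s \<in> S; x \<in> carrier G; a \<in> N x; s \<in> N x\<rbrakk> \<Longrightarrow> a \<otimes> s = s \<otimes> a"
begin

text \<open>If \<open>u\<close> starts with \<open>s\<close>, then \<open>s\<close> is the first
  inversion of the reduced word \<open>u @ [b]\<close> and, by the equation, \<open>a\<close> is the
  last one. Both are descents of one element, so they commute; then \<open>s\<close> cancels from
  the equation and the induction continues with the same \<open>a\<close>.\<close>

lemma exchange_commute:
  assumes "a \<in> S" "set u \<subseteq> S" "b \<in> S" "a \<otimes> wprod u = wprod u \<otimes> b"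
    and "distinct (inversions (u @ [b]))"
  shows "a = b \<and> (\<forall>c\<in>set u. a \<otimes> c = c \<otimes> a)"
  using assms
proof (induction u)
  case Nil
  then show ?case by simp
next
  case (Cons s u)
  have closed: "s \<in> S" "set u \<subseteq> S" "set (u @ [b]) \<subseteq> S" "set (s # u @ [b]) \<subseteq> S"
    using Cons.prems by auto
  have "conj_by (wprod (s # u)) b = a"
    using Cons.prems by (intro conj_by_eq_iff[THEN iffD2]) simp_all
  moreover have inv: "inversions (s # u @ [b]) = inversions (s # u) @ [conj_by (wprod (s # u)) b]"
    using inversions_append[of "s # u" "[b]"] Cons.prems by simp
  ultimately have a: "inversions (s # u @ [b]) = s # map (conj_by s) (inversions u) @ [a]"
    by simp
  have "N (wprod (s # u @ [b])) = set (inversions (s # u @ [b]))"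
    using closed Cons.prems(5) by (intro N_wprod) auto
  moreover have "a \<in> set (inversions (s # u @ [b]))"
    by (simp only: a) simp
  ultimately have as: "a \<otimes> s = s \<otimes> a"
    using Cons.prems(1) closed by (intro descents_commute[of a s "wprod (s # u @ [b])"]) auto
  have "s \<otimes> (a \<otimes> wprod u) = a \<otimes> wprod (s # u)"
    using Cons.prems(1) closed by (simp add: as flip: m_assoc)
  also have "\<dots> = s \<otimes> (wprod u \<otimes> b)"
    using Cons.prems closed by (simp add: m_assoc)
  finally have "a \<otimes> wprod u = wprod u \<otimes> b"
    using Cons.prems closed by simp
  moreover have "distinct (inversions (u @ [b]))"
    using Cons.prems(5) closed distinct_inversions_Cons[of s "u @ [b]"] by simp
  ultimately show ?case
    using Cons closed as by auto
qed

text \<open>The two letters to be deleted coincide and can be brought together by commutations, so a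
  word is shortened by moves that the right-angled relators allow.\<close>

lemma commuting_pair:
  assumes "set ws \<subseteq> S" "\<not> distinct (inversions ws)"
  shows "\<exists>p a u v. ws = p @ a # u @ a # v \<and> (\<forall>c\<in>set u. a \<otimes> c = c \<otimes> a)"
proof -
  obtain p a u b v where ws: "ws = p @ a # u @ b # v" "a \<otimes> wprod u = wprod u \<otimes> b"
    "distinct (inversions (u @ [b]))"
    using not_distinct_inversions[OF assms] by auto
  have "a = b \<and> (\<forall>c\<in>set u. a \<otimes> c = c \<otimes> a)"
    using ws assms(1) by (intro exchange_commute) auto
  then show ?thesis using ws(1) by auto
qed

lemma wprod_commute:
  "\<lbrakk>a \<in> S; set u \<subseteq> S; \<forall>c\<in>set u. a \<otimes> c = c \<otimes> a\<rbrakk> \<Longrightarrow> a \<otimes> wprod u = wprod u \<otimes> a"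
proof (induction u)
  case (Cons c u)
  have "a \<otimes> (c \<otimes> wprod u) = (a \<otimes> c) \<otimes> wprod u"
    using Cons.prems(1,2) by (simp add: m_assoc)
  also have "\<dots> = (c \<otimes> a) \<otimes> wprod u"
    using Cons.prems by simp
  also have "\<dots> = c \<otimes> (a \<otimes> wprod u)"
    using Cons.prems(1,2) by (simp add: m_assoc)
  also have "\<dots> = c \<otimes> wprod u \<otimes> a"
    using Cons by (simp add: m_assoc)
  finally show ?case by simp
qed simp

end

section \<open>Commuting descents from the meet condition\<close>

context reflection_cocycle_group
begin

text \<open>Passing from \<open>x\<close> to \<open>s \<otimes> x\<close> removes the inversion
  \<open>s\<close> and turns \<open>a\<close> into \<open>q\<close>, the conjugate of
  \<open>a\<close> by \<open>s\<close>. Hence \<open>{q}\<close> is an intersection of two inversion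
  sets, and its meet makes \<open>q\<close> a generator.\<close>

lemma meet_descents_commute:
  assumes meet: "meet_intersection_condition G N"
    and S: "a \<in> S" "s \<in> S" and x: "x \<in> carrier G" "a \<in> N x" "s \<in> N x"
  shows "a \<otimes> s = s \<otimes> a"
proof (cases "a = s")
  case False
  define q where "q = conj_by s a"
  have q: "q \<in> carrier G" "q \<noteq> s" "conj_by s q = a"
    using S False by (auto simp: q_def conj_by_S_eq_iff conj_by_involution)
  have Nsa: "N (s \<otimes> a) = {s, q}"
    using S q(2) by (auto simp: N_mult_S N_S q_def)
  moreover have "s \<notin> N (s \<otimes> x)" "q \<in> N (s \<otimes> x)"
    using S x q by (simp_all add: mem_N_S_mult conj_by_S_eq_iff[THEN iffD2])
  ultimately have "N (s \<otimes> x) \<inter> N (s \<otimes> a) = {q}"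
    by auto
  moreover have "\<exists>z. z \<in> carrier G \<and> N z = N (s \<otimes> x) \<inter> N (s \<otimes> a)"
    using meet S x unfolding meet_intersection_condition_def by (metis S_closed m_closed)
  ultimately obtain z where "z \<in> carrier G" "N z = {q}"
    by auto
  \<comment> \<open>\<open>z\<close> is not the identity, so some generator lies in
    \<open>N z\<close>, and \<open>q\<close> is the only candidate.\<close>
  then have "q \<in> S"
    using ex_N_S[of z] by fastforce
  moreover have "q = s \<otimes> a \<otimes> s"
    using S by (simp add: q_def conj_by_def inv_S)
  \<comment> \<open>\<open>N q\<close> in two ways: as the singleton of a generator, and by the
    cocycle identity for \<open>s \<otimes> a \<otimes> s\<close>. Only the conjugate of
    \<open>s\<close> can cancel \<open>s\<close> on the left.\<close>
  ultimately have "sym_diff {s, q} {conj_by (s \<otimes> a) s} = {q}"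
    using N_S[of q] N_mult_S[of "s \<otimes> a" s] S Nsa by simp
  then have "conj_by (s \<otimes> a) s = s"
    using q(2) by auto
  then have "conj_by a s = s"
    using S by (simp add: conj_by_mult conj_by_S_eq_iff)
  then show ?thesis
    using S by (simp add: conj_by_eq_iff)
qed simp

end

section \<open>Right-angled presentations\<close>

text \<open>Exponent 1 occurs only on the diagonal and gives the squares, exponent 2 gives the
  commutation relators, and \<open>\<infinity>\<close> is no \<open>enat k\<close>.\<close>

lemma coxeter_relators_right_angled:
  assumes "right_angled_coxeter_matrix S m"
  shows "coxeter_relators S m = {[(r, True), (r, True)] | r. r \<in> S} \<union>
    {[(r, True), (s, True), (r, True), (s, True)] | r s. r \<in> S \<and> s \<in> S \<and> m r s = 2}"
    (is "_ = ?A \<union> ?B")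
proof (intro equalityI subsetI)
  fix w assume "w \<in> coxeter_relators S m"
  then obtain r s k where w: "w = concat (replicate k [(r, True), (s, True)])"
    and rs: "r \<in> S" "s \<in> S" "m r s = enat k"
    by (auto simp: coxeter_relators_def)
  consider "r = s" "m r s = 1" | "m r s = 2"
    using assms rs unfolding right_angled_coxeter_matrix_def by (metis enat.distinct(1))
  then show "w \<in> ?A \<union> ?B"
  proof cases
    case 1
    then have "k = 1" using rs by (simp add: one_enat_def)
    then show ?thesis using w rs 1 by simp
  next
    case 2
    then have "k = 2" using rs by (simp add: numeral_eq_enat)
    then show ?thesis using w rs 2 by (simp add: numeral_2_eq_2)
  qed
next
  fix w assume "w \<in> ?A \<union> ?B"
  then consider r where "w = [(r, True), (r, True)]" "r \<in> S"
    | r s where "w = [(r, True), (s, True), (r, True), (s, True)]" "r \<in> S" "s \<in> S" "m r s = 2"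
    by auto
  then show "w \<in> coxeter_relators S m"
  proof cases
    case 1
    moreover have "m r r = enat 1"
      using assms 1 by (simp add: right_angled_coxeter_matrix_def one_enat_def)
    ultimately show ?thesis
      unfolding coxeter_relators_def mem_Collect_eq
      by (intro exI[of _ r] exI[of _ r] exI[of _ 1]) simp
  next
    case 2
    then show ?thesis
      unfolding coxeter_relators_def mem_Collect_eq
      by (intro exI[of _ r] exI[of _ s] exI[of _ 2]) (simp add: numeral_2_eq_2 numeral_eq_enat)
  qed
qed

text \<open>Modulo the relators every word is congruent to one without formal inverses, so lists
  over \<open>S\<close> suffice for the word problem.\<close>

definition positive :: "'a list \<Rightarrow> 'a gword" where
  "positive ws = map (\<lambda>s. (s, True)) ws"

lemma positive_simps [simp]:
  "positive [] = []"
  "positive (s # ws) = (s, True) # positive ws"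
  "positive (u @ v) = positive u @ positive v"
  "map fst (positive ws) = ws"
  by (simp_all add: positive_def comp_def)

lemma positive_gwords [simp]: "positive ws \<in> gwords S \<longleftrightarrow> set ws \<subseteq> S"
  by (induction ws) auto

locale right_angled_presentation =
  fixes S :: "'a set" and m :: "'a \<Rightarrow> 'a \<Rightarrow> enat"
  assumes matrix: "right_angled_coxeter_matrix S m"
begin

abbreviation rel where "rel \<equiv> presentation_rel S (coxeter_relators S m)"

lemma rel_square:
  assumes "set p \<subseteq> S" "r \<in> S" "set q \<subseteq> S"
  shows "(positive (p @ [r, r] @ q), positive (p @ q)) \<in> rel"
  using presentation_rel.relator[of "positive p" S "positive q" "positive [r, r]"
      "coxeter_relators S m"] assms
  by (auto simp: coxeter_relators_right_angled[OF matrix])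

text \<open>Insert the relator in front and delete squares: \<open>sr\<close>,
  \<open>rsrssr\<close>, \<open>rsrr\<close>, \<open>rs\<close>.\<close>

lemma rel_swap:
  assumes "set p \<subseteq> S" "r \<in> S" "s \<in> S" "m r s = 2" "set q \<subseteq> S"
  shows "(positive (p @ [s, r] @ q), positive (p @ [r, s] @ q)) \<in> rel"
proof -
  have "(positive p @ positive [r, s, r, s] @ positive ([s, r] @ q),
      positive p @ positive ([s, r] @ q)) \<in> rel"
    using assms by (intro presentation_rel.relator)
      (auto simp: coxeter_relators_right_angled[OF matrix])
  then have "(positive (p @ [s, r] @ q), positive ((p @ [r, s, r]) @ [s, s] @ [r] @ q)) \<in> rel"
    by (auto intro: presentation_rel.sym)
  also have "(positive ((p @ [r, s, r]) @ [s, s] @ [r] @ q),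
      positive ((p @ [r, s, r]) @ [r] @ q)) \<in> rel"
    using assms by (intro rel_square) auto
  also (presentation_rel.trans) have "(positive ((p @ [r, s, r]) @ [r] @ q),
      positive (p @ [r, s] @ q)) \<in> rel"
    using rel_square[of "p @ [r, s]" r q] assms by auto
  finally (presentation_rel.trans) show ?thesis .
qed

text \<open>The left \<open>a\<close> moves through \<open>u\<close> letter by letter until it meets
  the right one; past a letter equal to \<open>a\<close> the move changes nothing.\<close>

lemma rel_delete_pair:
  assumes "set p \<subseteq> S" "a \<in> S" "set u \<subseteq> S" "set v \<subseteq> S"
    and "\<forall>c\<in>set u. c = a \<or> m a c = 2"
  shows "(positive (p @ [a] @ u @ [a] @ v), positive (p @ u @ v)) \<in> rel"
  using assms
proof (induction u arbitrary: p)
  case Nil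
  then show ?case using rel_square[of p a v] by simp
next
  case (Cons c u)
  have "(positive (p @ [a, c] @ u @ [a] @ v), positive (p @ [c, a] @ u @ [a] @ v)) \<in> rel"
  proof (cases "c = a")
    case True
    then show ?thesis using Cons.prems by (auto intro: presentation_rel.refl)
  next
    case False
    then show ?thesis using Cons.prems by (intro presentation_rel.sym[OF rel_swap]) auto
  qed
  also have "(positive (p @ [c, a] @ u @ [a] @ v), positive (p @ (c # u) @ v)) \<in> rel"
    using Cons.IH[of "p @ [c]"] Cons.prems by simp
  finally (presentation_rel.trans) show ?case by simp
qed

text \<open>A formal inverse of \<open>s\<close> becomes \<open>s\<close>: put the square of
  \<open>s\<close> in front of it and cancel the adjacent opposite letters.\<close>

lemma rel_positive: "w \<in> gwords S \<Longrightarrow> (w, positive (map fst w)) \<in> rel"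
proof (induction w)
  case Nil
  then show ?case by (auto intro: presentation_rel.refl)
next
  case (Cons l w)
  obtain s b where l: "l = (s, b)" by (cases l)
  have s: "s \<in> S" using Cons.prems l by simp
  have "([(s, b)], [(s, True)]) \<in> rel"
  proof (cases b)
    case False
    have "(positive ([] @ [s, s] @ []) @ [(s, False)], positive ([] @ []) @ [(s, False)]) \<in> rel"
      using s by (intro presentation_rel_append rel_square) (auto intro: presentation_rel.refl)
    then have "([(s, False)], [(s, True)] @ [(s, True), (s, \<not> True)] @ []) \<in> rel"
      by (auto intro: presentation_rel.sym)
    also have "([(s, True)] @ [(s, True), (s, \<not> True)] @ [], [(s, True)] @ []) \<in> rel"
      using s by (intro presentation_rel.cancel) auto
    finally (presentation_rel.trans) show ?thesis using False by simp
  qed (use s in \<open>auto intro: presentation_rel.refl\<close>)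
  then show ?case
    using presentation_rel_append[of "[(s, b)]" "[(s, True)]" S _ w] Cons l by fastforce
qed

end

lemma (in involution_generated) eval_gword_eq_wprod:
  "w \<in> gwords S \<Longrightarrow> eval_gword G w = wprod (map fst w)"
  by (induction w) (auto simp: inv_S)

context commuting_descents
begin

definition commutation_matrix :: "'a \<Rightarrow> 'a \<Rightarrow> enat" where
  "commutation_matrix r s = (if r = s then 1 else if r \<otimes> s = s \<otimes> r then 2 else \<infinity>)"

sublocale right_angled_presentation S commutation_matrix
  by unfold_locales (auto simp: right_angled_coxeter_matrix_def commutation_matrix_def
      one_enat_def numeral_eq_enat)

text \<open>Left multiplication by the generators satisfies the relators, and the orbit of
  \<open>\<one>\<close> records the product.\<close>

lemma rel_imp_wprod_eq:
  assumes "(positive u, positive v) \<in> rel"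
  shows "wprod u = wprod v"
proof -
  have "foldr (\<lambda>l x. fst l \<otimes> x) (positive u) \<one> = foldr (\<lambda>l x. fst l \<otimes> x) (positive v) \<one>"
    using assms
  proof (rule foldr_presentation_rel[where X = "carrier G"])
    fix w x assume w: "w \<in> coxeter_relators S commutation_matrix" and x: "x \<in> carrier G"
    consider r where "w = [(r, True), (r, True)]" "r \<in> S"
      | r s where "w = [(r, True), (s, True), (r, True), (s, True)]" "r \<in> S" "s \<in> S"
          "r \<otimes> s = s \<otimes> r"
      using w unfolding coxeter_relators_right_angled[OF matrix]
      by (auto simp: commutation_matrix_def one_enat_def numeral_eq_enat split: if_splits)
    then show "foldr (\<lambda>l x. fst l \<otimes> x) w x = x"
    proof cases
      case 2
      have "r \<otimes> (s \<otimes> (r \<otimes> (s \<otimes> x))) = r \<otimes> s \<otimes> (r \<otimes> s) \<otimes> x"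
        using 2(2,3) x by (simp add: m_assoc)
      also have "r \<otimes> s \<otimes> (r \<otimes> s) = r \<otimes> s \<otimes> (s \<otimes> r)"
        using 2 by simp
      also have "\<dots> = \<one>"
        using 2(2,3) by (simp add: m_assoc involution_cancel involution)
      finally show ?thesis using 2 x by simp
    qed (use x in \<open>simp add: involution_cancel\<close>)
  qed (auto simp: involution_cancel)
  moreover have "foldr (\<lambda>l x. fst l \<otimes> x) (positive w) \<one> = wprod w" for w
    by (induction w) auto
  ultimately show ?thesis by simp
qed

lemma ex_rel_reduced:
  assumes "set ws \<subseteq> S"
  shows "\<exists>ws'. set ws' \<subseteq> S \<and> distinct (inversions ws') \<and> (positive ws, positive ws') \<in> rel"
  using assms
proof (induction ws rule: length_induct)
  case (1 ws)
  show ?case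
  proof (cases "distinct (inversions ws)")
    case True
    then show ?thesis
      using "1.prems" by (intro exI[of _ ws]) (simp add: presentation_rel.refl)
  next
    case False
    then obtain p a u v where ws: "ws = p @ a # u @ a # v" "\<forall>c\<in>set u. a \<otimes> c = c \<otimes> a"
      using commuting_pair "1.prems" by blast
    have "(positive ws, positive (p @ u @ v)) \<in> rel"
      using rel_delete_pair[of p a u v] ws "1.prems" by (auto simp: commutation_matrix_def)
    moreover have "\<exists>ws'. set ws' \<subseteq> S \<and> distinct (inversions ws') \<and>
        (positive (p @ u @ v), positive ws') \<in> rel"
      using "1.prems" ws by (intro "1.IH"[rule_format]) auto
    ultimately show ?thesis
      by (meson presentation_rel.trans)
  qed
qed

text \<open>A word with product \<open>\<one>\<close> is congruent to a reduced word whose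
  inversions make up \<open>N \<one>\<close>, hence to the empty word. For the general case,
  \<open>v @ rev v @ u\<close> is congruent both to \<open>u\<close> and to
  \<open>v\<close>.\<close>

lemma wprod_eq_imp_rel:
  assumes "set u \<subseteq> S" "set v \<subseteq> S" "wprod u = wprod v"
  shows "(positive u, positive v) \<in> rel"
proof -
  have one: "(positive w, []) \<in> rel" if w: "set w \<subseteq> S" "wprod w = \<one>" for w
  proof -
    obtain w' where w': "set w' \<subseteq> S" "distinct (inversions w')" "(positive w, positive w') \<in> rel"
      using ex_rel_reduced[OF w(1)] by blast
    then have "N (wprod w') = set (inversions w')"
      by (intro N_wprod) auto
    then have "set (inversions w') = {}"
      using rel_imp_wprod_eq[OF w'(3)] w(2) N_one by metis
    then have "w' = []"
      using length_inversions[of w'] by simp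
    then show ?thesis using w'(3) by simp
  qed
  have "(positive (v @ rev v) @ positive u, [] @ positive u) \<in> rel"
    using assms by (intro presentation_rel_append one) (auto simp: wprod_append wprod_rev
        intro: presentation_rel.refl)
  moreover have "(positive v @ positive (rev v @ u), positive v @ []) \<in> rel"
    using assms by (intro presentation_rel_append one) (auto simp: wprod_append wprod_rev
        intro: presentation_rel.refl)
  ultimately show ?thesis
    by (auto intro: presentation_rel.sym presentation_rel.trans)
qed

lemma right_angled_coxeter_system: "right_angled_coxeter_system G S"
proof -
  have "(u, v) \<in> rel \<longleftrightarrow> eval_gword G u = eval_gword G v" if uv: "u \<in> gwords S" "v \<in> gwords S" for u v
  proof -
    have "(u, v) \<in> rel \<longleftrightarrow> (positive (map fst u), positive (map fst v)) \<in> rel"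
      using rel_positive[OF uv(1)] rel_positive[OF uv(2)]
      by (meson presentation_rel.sym presentation_rel.trans)
    also have "\<dots> \<longleftrightarrow> wprod (map fst u) = wprod (map fst v)"
    proof
      have "set (map fst u) \<subseteq> S" "set (map fst v) \<subseteq> S"
        using uv by (auto simp: gwords_def)
      then show "(positive (map fst u), positive (map fst v)) \<in> rel"
        if "wprod (map fst u) = wprod (map fst v)"
        using that wprod_eq_imp_rel by blast
    qed (rule rel_imp_wprod_eq)
    finally show ?thesis using uv by (simp add: eval_gword_eq_wprod)
  qed
  moreover have "eval_gword G ` gwords S = carrier G"
  proof (intro equalityI subsetI)
    fix x assume "x \<in> carrier G"
    then obtain ws where "set ws \<subseteq> S" "wprod ws = x" using ex_word by auto
    then have "positive ws \<in> gwords S" "eval_gword G (positive ws) = x"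
      by (simp_all add: eval_gword_eq_wprod)
    then show "x \<in> eval_gword G ` gwords S" by blast
  qed (use S_subset eval_gword_closed in auto)
  ultimately have "\<exists>\<phi>\<in>iso (presented_group S (coxeter_relators S commutation_matrix)) G.
      \<forall>s\<in>S. \<phi> (word_class S (coxeter_relators S commutation_matrix) [(s, True)]) = s"
    using iso_presented_group_iff[OF S_subset] by simp
  then show ?thesis
    using matrix S_subset is_group unfolding right_angled_coxeter_system_def by blast
qed

end

section \<open>Meets\<close>

context commuting_descents
begin

text \<open>The gate \<open>g\<close> of a reflection \<open>t\<close>: \<open>t\<close> is its only inversion that corresponds to a right
  descent.\<close>

lemma ex_gate:
  assumes x: "x \<in> carrier G" "t \<in> N x"
  shows "\<exists>g\<in>carrier G. N g \<subseteq> N x \<and> t \<in> N g \<and>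
    (\<forall>c\<in>S. conj_by g c \<in> N g \<longrightarrow> conj_by g c = t) \<and> (\<exists>s\<in>S. conj_by g s = t)"
proof -
  let ?P = "\<lambda>g. g \<in> carrier G \<and> N g \<subseteq> N x \<and> t \<in> N g"
  obtain g where g: "?P g" and min: "\<And>h. ?P h \<Longrightarrow> card (N g) \<le> card (N h)"
    using ex_has_least_nat[of ?P x "\<lambda>g. card (N g)"] x by blast
  have unique: "conj_by g c = t" if c: "c \<in> S" "conj_by g c \<in> N g" for c
  proof (rule ccontr)
    assume neq: "conj_by g c \<noteq> t"
    \<comment> \<open>Otherwise \<open>g \<otimes> c\<close> would lose this inversion but keep
      \<open>t\<close>, against the minimality of \<open>g\<close>.\<close>
    have N: "N (g \<otimes> c) = N g - {conj_by g c}"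
      using c g by (auto simp: N_mult_S)
    have "card (N g) \<le> card (N (g \<otimes> c))"
      using g c neq by (intro min) (auto simp: N)
    moreover have "card (N (g \<otimes> c)) < card (N g)"
      using c g finite_N by (simp only: N) (intro card_Diff1_less, auto)
    ultimately show False by simp
  qed
  obtain ws where ws: "set ws \<subseteq> S" "wprod ws = g" "N g = set (inversions ws)"
    using ex_reduced_N g by blast
  \<comment> \<open>The last letter of a reduced word for \<open>g\<close> is a right descent; by
    uniqueness its reflection is \<open>t\<close>.\<close>
  then have "ws \<noteq> []" using g by auto
  then obtain u s where u: "ws = u @ [s]" by (metis rev_exhaust)
  have s: "s \<in> S" "set u \<subseteq> S" using ws u by auto
  then have "conj_by g s = conj_by (wprod u) s"
    using ws(2) u conj_by_wprod_snoc by auto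
  then have "conj_by g s \<in> N g"
    using ws u s by (simp add: inversions_append)
  then show ?thesis using g unique s by blast
qed

text \<open>Take the last letter of \<open>u\<close> that makes the word up to the end of
  \<open>v\<close> non-reduced. As \<open>u\<close> is reduced, the clash is with a letter of
  \<open>v\<close>, and by \<open>exchange_commute\<close> the two letters agree and commute with
  everything between them.\<close>

lemma overlap_letter:
  assumes "set u \<subseteq> S" "set v \<subseteq> S" "distinct (inversions u)" "distinct (inversions v)"
    and "\<not> distinct (inversions (u @ v))"
  shows "\<exists>p a q. u = p @ a # q \<and> a \<in> set v \<and> (\<forall>c\<in>set q. a \<otimes> c = c \<otimes> a)"
  using assms
proof (induction u)
  case (Cons r u)
  have S: "r \<in> S" "set u \<subseteq> S" "set (u @ v) \<subseteq> S" using Cons.prems by auto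
  have u: "distinct (inversions u)" "r \<notin> set (inversions u)"
    using Cons.prems(3) distinct_inversions_Cons[OF S(1,2)] by auto
  show ?case
  proof (cases "distinct (inversions (u @ v))")
    case False
    then obtain p a q where "u = p @ a # q" "a \<in> set v" "\<forall>c\<in>set q. a \<otimes> c = c \<otimes> a"
      using Cons.IH Cons.prems(2,4) S u by blast
    then show ?thesis by (intro exI[of _ "r # p"]) auto
  next
    case True
    then have "r \<in> set (inversions (u @ v))"
      using Cons.prems(5) distinct_inversions_Cons[OF S(1,3)] unfolding append_Cons by blast
    then obtain t where t: "t \<in> set (inversions v)" "r = conj_by (wprod u) t"
      using u S Cons.prems(2) by (auto simp: inversions_append)
    then obtain v1 b v2 where v: "v = v1 @ b # v2" "t = conj_by (wprod v1) b"
      using mem_inversions_iff Cons.prems(2) by metis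
    have S': "b \<in> S" "set v1 \<subseteq> S" "set v2 \<subseteq> S" using v Cons.prems(2) by auto
    have "r = conj_by (wprod (u @ v1)) b"
      using t v S S' by (simp add: wprod_append conj_by_mult)
    then have "r \<otimes> wprod (u @ v1) = wprod (u @ v1) \<otimes> b"
      using conj_by_eq_iff[of "wprod (u @ v1)" b r] S S' by simp
    moreover have "distinct (inversions ((u @ v1) @ [b]))"
      using distinct_inversions_prefix[of "(u @ v1) @ [b]" v2] True v S S' by simp
    ultimately have "r = b \<and> (\<forall>c\<in>set (u @ v1). r \<otimes> c = c \<otimes> r)"
      using S S' by (intro exchange_commute) auto
    then show ?thesis
      using v by (intro exI[of _ "[]"]) auto
  qed
qed simp

text \<open>Write \<open>h\<close> as \<open>g \<otimes> d\<close> with a reduced word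
  \<open>D\<close> for \<open>d\<close>. Exchange shows that \<open>s\<close> commutes with all
  letters of \<open>D\<close>, and \<open>s\<close> is not among them. A nonempty \<open>D\<close>
  would give \<open>g\<close> or \<open>h\<close> a right descent that is a letter of
  \<open>D\<close>, whereas \<open>s\<close> is the only right descent of either.\<close>

lemma gate_unique:
  assumes g: "g \<in> carrier G" "t \<in> N g" "s \<in> S" "conj_by g s = t"
      "\<And>c. \<lbrakk>c \<in> S; conj_by g c \<in> N g\<rbrakk> \<Longrightarrow> conj_by g c = t"
    and h: "h \<in> carrier G" "t \<in> N h" "s' \<in> S" "conj_by h s' = t"
      "\<And>c. \<lbrakk>c \<in> S; conj_by h c \<in> N h\<rbrakk> \<Longrightarrow> conj_by h c = t"
  shows "g = h"
proof -
  define d where "d = inv g \<otimes> h"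
  have d: "d \<in> carrier G" "h = g \<otimes> d"
    using g(1) h(1) by (simp_all add: d_def flip: m_assoc)
  have t: "t \<in> carrier G" using N_subset[OF g(1)] g(2) by blast
  have gt: "conj_by (inv g) t = s"
    using g(1,3,4) t by (simp add: conj_by_inv_iff)
  \<comment> \<open>\<open>t\<close> lies in both \<open>N g\<close> and \<open>N h\<close>, so the
    second term of the cocycle identity does not contain it.\<close>
  have "s \<notin> N d"
    using mem_N_mult[of g d t] g(1,2) h(2) d t gt by simp
  have "conj_by g (conj_by d s') = conj_by g s"
    using g(1,4) h(3,4) d by (simp flip: conj_by_mult)
  then have ds: "conj_by d s' = s"
    using g(1,3) h(3) d(1) by (simp add: conj_by_inject)
  obtain D where D: "set D \<subseteq> S" "wprod D = d" "distinct (inversions D)" "N d = set (inversions D)"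
    using ex_reduced_N[OF d(1)] by blast
  obtain H where H: "set H \<subseteq> S" "wprod H = g" "distinct (inversions H)" "N g = set (inversions H)"
    using ex_reduced_N[OF g(1)] by blast
  have "distinct (inversions (D @ [s']))"
    using D h(3) ds \<open>s \<notin> N d\<close> by (simp add: inversions_append)
  moreover have "s \<otimes> wprod D = wprod D \<otimes> s'"
    using ds D h(3) g(3) d(1) by (simp add: conj_by_eq_iff)
  ultimately have s: "s = s'" "\<And>c. c \<in> set D \<Longrightarrow> s \<otimes> c = c \<otimes> s"
    using exchange_commute[of s D s'] D(1) g(3) h(3) by auto
  have "s \<notin> set D"
  proof
    assume "s \<in> set D"
    then obtain p q where pq: "D = p @ s # q" by (meson split_list)
    then have "s \<otimes> wprod p = wprod p \<otimes> s"
      using D(1) g(3) s(2) by (intro wprod_commute) auto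
    then have "s = conj_by (wprod p) s"
      using D(1) g(3) pq conj_by_eq_iff[of "wprod p" s s] by simp
    then have "s \<in> N d"
      using D pq mem_inversions_iff by metis
    then show False using \<open>s \<notin> N d\<close> by simp
  qed
  have "D = []"
  proof (rule ccontr)
    assume "D \<noteq> []"
    show False
    proof (cases "distinct (inversions (H @ D))")
      case True
      \<comment> \<open>Here the last letter of \<open>D\<close> is a right descent of
        \<open>h\<close>.\<close>
      obtain D' c where D': "D = D' @ [c]" using \<open>D \<noteq> []\<close> by (metis rev_exhaust)
      have c: "c \<in> S" "set D' \<subseteq> S" using D D' by auto
      have hw: "h = wprod ((H @ D') @ [c])" using d D H D' c by (simp add: wprod_append m_assoc)
      have "conj_by h c = conj_by (wprod (H @ D')) c"
        unfolding hw using c H by (intro conj_by_wprod_snoc) auto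
      moreover have "N h = set (inversions ((H @ D') @ [c]))"
        unfolding hw using True c H D' by (intro N_wprod) auto
      ultimately have "conj_by h c \<in> N h"
        using c H by (subst (asm) inversions_append) auto
      then have "conj_by h c = conj_by h s" using h(4,5) s c by simp
      then have "c = s" using c g(3) h(1) by (simp add: conj_by_inject)
      then show False using \<open>s \<notin> set D\<close> D' by simp
    next
      case False
      \<comment> \<open>Here \<open>a\<close> can be moved to the end of \<open>H\<close>, which
        makes it a right descent of \<open>g\<close>.\<close>
      then obtain p a q where a: "H = p @ a # q" "a \<in> set D" "\<forall>c\<in>set q. a \<otimes> c = c \<otimes> a"
        using overlap_letter H D by blast
      have S: "a \<in> S" "set p \<subseteq> S" "set q \<subseteq> S" using H a by auto
      have "wprod (a # q) = wprod q \<otimes> a"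
        using wprod_commute[of a q] S a by simp
      then have "g = wprod p \<otimes> wprod q \<otimes> a"
        using H a S by (auto simp: wprod_append m_assoc)
      then have "conj_by g a = conj_by (wprod p) (conj_by (wprod q) a)"
        using S by (simp add: conj_by_mult conj_by_S_eq_iff[THEN iffD2])
      also have "conj_by (wprod q) a = a"
        using wprod_commute[of a q] S a by (simp add: conj_by_eq_iff)
      finally have "conj_by g a \<in> N g"
        using H a mem_inversions_iff by metis
      then have "conj_by g a = conj_by g s" using g(4,5) S by simp
      then have "a = s" using g(1,3) S by (simp add: conj_by_inject)
      then show False using \<open>s \<notin> set D\<close> a by simp
    qed
  qed
  then show ?thesis using d(2) D(2) g(1) by auto
qed

text \<open>Both elements have the same gate for \<open>t\<close>, and a left descent of the gate is
  inherited by both.\<close>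

lemma common_descent:
  assumes "x \<in> carrier G" "y \<in> carrier G" "t \<in> N x" "t \<in> N y"
  shows "\<exists>r\<in>S. r \<in> N x \<and> r \<in> N y"
proof -
  obtain g s where g: "g \<in> carrier G" "N g \<subseteq> N x" "t \<in> N g" "s \<in> S" "conj_by g s = t"
    "\<And>c. \<lbrakk>c \<in> S; conj_by g c \<in> N g\<rbrakk> \<Longrightarrow> conj_by g c = t"
    using ex_gate[OF assms(1,3)] by blast
  obtain h s' where h: "h \<in> carrier G" "N h \<subseteq> N y" "t \<in> N h" "s' \<in> S" "conj_by h s' = t"
    "\<And>c. \<lbrakk>c \<in> S; conj_by h c \<in> N h\<rbrakk> \<Longrightarrow> conj_by h c = t"
    using ex_gate[OF assms(2,4)] by blast
  have "g = h"
    using gate_unique[of g t s h s'] g h by blast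
  moreover have "g \<noteq> \<one>"
    using g(3) by auto
  ultimately show ?thesis
    using ex_N_S[OF g(1)] g(2) h(2) by blast
qed

lemma meet_intersection: "meet_intersection_condition G N"
  unfolding meet_intersection_condition_def
proof (intro ballI)
  fix x y assume xy: "x \<in> carrier G" "y \<in> carrier G"
  let ?P = "\<lambda>z. z \<in> carrier G \<and> N z \<subseteq> N x \<inter> N y"
  \<comment> \<open>A maximal \<open>z\<close> exists, as \<open>\<one>\<close> qualifies and
    \<open>N x\<close> is finite.\<close>
  have "\<forall>z. ?P z \<longrightarrow> card (N z) < Suc (card (N x))"
    using finite_N[OF xy(1)] by (simp add: card_mono less_Suc_eq_le)
  then have "\<exists>z. ?P z \<and> (\<forall>w. ?P w \<longrightarrow> card (N w) \<le> card (N z))"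
    by (intro Lattices_Big.ex_has_greatest_nat[of ?P \<one>]) auto
  then obtain z where z: "?P z" and max: "\<And>w. ?P w \<Longrightarrow> card (N w) \<le> card (N z)"
    by metis
  have "t \<in> N z" if t: "t \<in> N x" "t \<in> N y" for t
  proof (rule ccontr)
    assume tz: "t \<notin> N z"
    \<comment> \<open>After translation by \<open>inv z\<close> the missing inversion is common to
      \<open>x'\<close> and \<open>y'\<close>, so they share a descent \<open>r\<close>, and
      \<open>z \<otimes> r\<close> will contradict maximality.\<close>
    define x' y' where "x' = inv z \<otimes> x" and "y' = inv z \<otimes> y"
    have closed: "x' \<in> carrier G" "y' \<in> carrier G" and eq: "x = z \<otimes> x'" "y = z \<otimes> y'"
      using z xy by (simp_all add: x'_def y'_def flip: m_assoc)
    have "t \<in> carrier G" using N_subset xy t by blast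
    then have "conj_by (inv z) t \<in> N x'" "conj_by (inv z) t \<in> N y'"
      using mem_N_mult[of z x' t] mem_N_mult[of z y' t] t tz z closed by (simp_all flip: eq)
    then obtain r where r: "r \<in> S" "r \<in> N x'" "r \<in> N y'"
      using common_descent closed by blast
    let ?q = "conj_by z r"
    have q: "?q \<in> carrier G" "conj_by (inv z) ?q = r"
      using r z by (simp_all add: conj_by_inv_iff)
    have "?q \<in> N x \<longleftrightarrow> ?q \<notin> N z" "?q \<in> N y \<longleftrightarrow> ?q \<notin> N z"
      using mem_N_mult[of z x' ?q] mem_N_mult[of z y' ?q] z closed q r by (simp_all flip: eq)
    \<comment> \<open>If \<open>?q\<close> were in \<open>N z\<close>, it would be in
      \<open>N x\<close> as well, which the equivalence excludes.\<close>
    then have q': "?q \<notin> N z" "?q \<in> N x" "?q \<in> N y"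
      using z by auto
    then have N: "N (z \<otimes> r) = insert ?q (N z)"
      using z r by (auto simp: N_mult_S)
    have "card (N (z \<otimes> r)) \<le> card (N z)"
      using z r q' by (intro max) (auto simp: N)
    then show False
      using q' z finite_N by (simp add: N)
  qed
  then have "N z = N x \<inter> N y"
    using z by blast
  then show "\<exists>!z. z \<in> carrier G \<and> N z = N x \<inter> N y"
    using z N_eqD by (intro ex1I[of _ z]) auto
qed

end

section \<open>The cocycle of a right-angled Coxeter system\<close>

text \<open>The infinite dihedral group acting on the line by reflections in \<open>0\<close> and \<open>2\<close>; the point \<open>1\<close>
  lies between the two mirrors.\<close>

definition line_action :: "'a \<Rightarrow> 'a \<Rightarrow> 'a \<Rightarrow> int \<Rightarrow> int" where
  "line_action a s r n = (if r = a then - n else if r = s then 4 - n else n)"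

text \<open>The head acts last: reflection in \<open>0\<close> sends \<open>1\<close> and all points
  beyond \<open>2\<close> below \<open>0\<close>, and reflection in \<open>2\<close> sends
  \<open>1\<close> and all negative points beyond \<open>2\<close>.\<close>

lemma line_action_ping_pong:
  assumes "set ws \<subseteq> {a, s}" "distinct_adj ws" "ws \<noteq> []" "a \<noteq> s"
  shows "(hd ws = a \<longrightarrow> foldr (line_action a s) ws 1 < 0) \<and>
    (hd ws = s \<longrightarrow> foldr (line_action a s) ws 1 > 2)"
  using assms
proof (induction ws)
  case (Cons r ws)
  then show ?case
    by (cases ws) (auto simp: line_action_def)
qed simp

locale right_angled_coxeter = group G + right_angled_presentation S m
  for G :: "('a, 'b) monoid_scheme" (structure) and S :: "'a set" and m +
  assumes gens_closed: "S \<subseteq> carrier G"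
    and presentation: "\<lbrakk>u \<in> gwords S; v \<in> gwords S\<rbrakk>
      \<Longrightarrow> (u, v) \<in> rel \<longleftrightarrow> eval_gword G u = eval_gword G v"
    and eval_onto: "eval_gword G ` gwords S = carrier G"
begin

lemma square_one: "r \<in> S \<Longrightarrow> r \<otimes> r = \<one>"
  using rel_square[of "[]" r "[]"] presentation[of "positive [r, r]" "[]"] gens_closed
  by (auto simp: subset_eq)

sublocale involution_generated G S
proof
  have "eval_gword G w \<in> generate G S" if "w \<in> gwords S" for w
    using that
    by (induction w) (auto intro!: generate.one generate.eng intro: generate.incl generate.inv)
  then have "eval_gword G ` gwords S \<subseteq> generate G S"
    by (rule image_subsetI)
  then show "generate G S = carrier G"
    unfolding eval_onto by (intro subset_antisym generate_incl gens_closed)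
qed (simp_all add: gens_closed square_one)

lemma wprod_eq_iff:
  "\<lbrakk>set u \<subseteq> S; set v \<subseteq> S\<rbrakk> \<Longrightarrow> wprod u = wprod v \<longleftrightarrow> (positive u, positive v) \<in> rel"
  by (simp add: presentation eval_gword_eq_wprod)

lemma m_eq_2_commute:
  assumes "r \<in> S" "s \<in> S" "m r s = 2"
  shows "r \<otimes> s = s \<otimes> r"
  using rel_swap[of "[]" r s "[]"] wprod_eq_iff[of "[s, r]" "[r, s]"] assms by simp

text \<open>Involutive operations that commute wherever \<open>m\<close> is 2 define an action of
  the group. It is used on sets of group elements for the cocycle and on the integers for dihedral
  pairs.\<close>

lemma foldr_wprod_eq:
  assumes "set u \<subseteq> S" "set v \<subseteq> S" "wprod u = wprod v" "x \<in> X"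
    and closed: "\<And>r x. \<lbrakk>r \<in> S; x \<in> X\<rbrakk> \<Longrightarrow> f r x \<in> X"
    and square: "\<And>r x. \<lbrakk>r \<in> S; x \<in> X\<rbrakk> \<Longrightarrow> f r (f r x) = x"
    and commute: "\<And>r s x. \<lbrakk>r \<in> S; s \<in> S; m r s = 2; x \<in> X\<rbrakk> \<Longrightarrow> f r (f s x) = f s (f r x)"
  shows "foldr f u x = foldr f v x"
proof -
  have "(positive u, positive v) \<in> rel"
    using assms by (simp flip: wprod_eq_iff)
  then have "foldr (\<lambda>l. f (fst l)) (positive u) x = foldr (\<lambda>l. f (fst l)) (positive v) x"
  proof (rule foldr_presentation_rel[where X = X])
    fix w x assume "w \<in> coxeter_relators S m" and x: "x \<in> X"
    then consider r where "w = [(r, True), (r, True)]" "r \<in> S"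
      | r s where "w = [(r, True), (s, True), (r, True), (s, True)]" "r \<in> S" "s \<in> S" "m r s = 2"
      unfolding coxeter_relators_right_angled[OF matrix] by blast
    then show "foldr (\<lambda>l. f (fst l)) w x = x"
    proof cases
      case 2
      then have "f r (f s (f r (f s x))) = f s (f r (f r (f s x)))"
        using x by (intro commute) (auto intro: closed)
      then show ?thesis using 2 x by (simp add: square closed)
    qed (simp add: square x)
  qed (use assms(4) in \<open>auto simp: square intro: closed\<close>)
  moreover have "foldr (\<lambda>l. f (fst l)) (positive w) x = foldr f w x" for w
    by (induction w) auto
  ultimately show ?thesis by simp
qed

section \<open>Construction of the cocycle by an action on sets\<close>

definition flip_by :: "'a \<Rightarrow> 'a set \<Rightarrow> 'a set" where
  "flip_by r A = sym_diff {r} (conj_by r ` A)"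

lemma flip_by_closed: "\<lbrakk>r \<in> S; A \<subseteq> carrier G\<rbrakk> \<Longrightarrow> flip_by r A \<subseteq> carrier G"
  by (auto simp: flip_by_def)

lemma foldr_flip_by_closed:
  "\<lbrakk>set ws \<subseteq> S; A \<subseteq> carrier G\<rbrakk> \<Longrightarrow> foldr flip_by ws A \<subseteq> carrier G"
  by (induction ws) (simp_all add: flip_by_closed)

lemma mem_flip_by:
  "\<lbrakk>r \<in> S; A \<subseteq> carrier G; t \<in> carrier G\<rbrakk>
    \<Longrightarrow> t \<in> flip_by r A \<longleftrightarrow> (t = r) \<noteq> (conj_by r t \<in> A)"
  using mem_conj_by_image[of r t A] by (auto simp: flip_by_def inv_S)

lemma flip_by_square:
  assumes "r \<in> S" "A \<subseteq> carrier G"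
  shows "flip_by r (flip_by r A) = A"
proof -
  have "t \<in> flip_by r (flip_by r A) \<longleftrightarrow> t \<in> A" if "t \<in> carrier G" for t
    using assms that
    by (auto simp: mem_flip_by flip_by_closed conj_by_involution conj_by_S_eq_iff)
  then show ?thesis
    using assms flip_by_closed by (meson subset_antisym subset_iff)
qed

lemma flip_by_commute:
  assumes "r \<in> S" "s \<in> S" "r \<otimes> s = s \<otimes> r" "A \<subseteq> carrier G"
  shows "flip_by r (flip_by s A) = flip_by s (flip_by r A)"
proof -
  have "conj_by r t = s \<longleftrightarrow> t = s" "conj_by s t = r \<longleftrightarrow> t = r"
    "conj_by r (conj_by s t) = conj_by s (conj_by r t)" if "t \<in> carrier G" for t
  proof -
    have "conj_by r s = s" "conj_by s r = r"
      using assms by (simp_all add: conj_by_eq_iff)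
    then show "conj_by r t = s \<longleftrightarrow> t = s" "conj_by s t = r \<longleftrightarrow> t = r"
      using conj_by_inject[of r t s] conj_by_inject[of s t r] assms that by auto
    show "conj_by r (conj_by s t) = conj_by s (conj_by r t)"
      using assms that by (simp flip: conj_by_mult)
  qed
  then have "t \<in> flip_by r (flip_by s A) \<longleftrightarrow> t \<in> flip_by s (flip_by r A)"
    if "t \<in> carrier G" for t
    using assms that by (auto simp: mem_flip_by flip_by_closed)
  then show ?thesis
    using assms flip_by_closed by (meson subset_antisym subset_iff)
qed

definition cocycle_of :: "'a \<Rightarrow> 'a set" where
  "cocycle_of x = foldr flip_by (SOME ws. set ws \<subseteq> S \<and> wprod ws = x) {}"

lemma cocycle_of_wprod:
  assumes "set ws \<subseteq> S"
  shows "cocycle_of (wprod ws) = foldr flip_by ws {}"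
proof -
  let ?v = "SOME v. set v \<subseteq> S \<and> wprod v = wprod ws"
  have "set ?v \<subseteq> S \<and> wprod ?v = wprod ws"
    using assms by (intro someI[of "\<lambda>v. set v \<subseteq> S \<and> wprod v = wprod ws" ws]) simp
  moreover have "flip_by r (flip_by s A) = flip_by s (flip_by r A)"
    if "r \<in> S" "s \<in> S" "m r s = 2" "A \<in> Pow (carrier G)" for r s A
    using that by (intro flip_by_commute m_eq_2_commute) simp_all
  ultimately have "foldr flip_by ?v {} = foldr flip_by ws {}"
    using assms
    by (intro foldr_wprod_eq[where X = "Pow (carrier G)"])
      (simp_all add: flip_by_closed flip_by_square)
  then show ?thesis by (simp add: cocycle_of_def)
qed

text \<open>The flips act as affine maps: a word translates by its value at \<open>{}\<close> after
  conjugating by its product. This is the cocycle identity in pointwise form.\<close>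

lemma mem_foldr_flip_by:
  "\<lbrakk>set ws \<subseteq> S; A \<subseteq> carrier G; t \<in> carrier G\<rbrakk> \<Longrightarrow>
    t \<in> foldr flip_by ws A \<longleftrightarrow> (t \<in> foldr flip_by ws {}) \<noteq> (conj_by (inv (wprod ws)) t \<in> A)"
proof (induction ws arbitrary: t)
  case (Cons r ws)
  have "conj_by (inv (r \<otimes> wprod ws)) t = conj_by (inv (wprod ws)) (conj_by r t)"
    using Cons.prems by (simp add: inv_mult_group conj_by_mult inv_S)
  then show ?case
    using Cons.IH[of "conj_by r t"] Cons.prems
    by (auto simp: mem_flip_by foldr_flip_by_closed)
qed simp

lemma cocycle_of_mult:
  assumes x: "x \<in> carrier G" and y: "y \<in> carrier G"
  shows "cocycle_of (x \<otimes> y) = sym_diff (cocycle_of x) (conj_by x ` cocycle_of y)"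
proof -
  obtain u v where u: "set u \<subseteq> S" "wprod u = x" and v: "set v \<subseteq> S" "wprod v = y"
    using ex_word x y by metis
  have cuv: "cocycle_of x = foldr flip_by u {}" "cocycle_of y = foldr flip_by v {}"
    "cocycle_of (x \<otimes> y) = foldr flip_by u (foldr flip_by v {})"
    using cocycle_of_wprod[of u] cocycle_of_wprod[of v] cocycle_of_wprod[of "u @ v"] u v
    by (auto simp: wprod_append)
  have sub: "cocycle_of x \<subseteq> carrier G" "cocycle_of y \<subseteq> carrier G" "cocycle_of (x \<otimes> y) \<subseteq> carrier G"
    unfolding cuv using u v by (simp_all add: foldr_flip_by_closed)
  have "t \<in> cocycle_of (x \<otimes> y) \<longleftrightarrow> t \<in> sym_diff (cocycle_of x) (conj_by x ` cocycle_of y)"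
    if "t \<in> carrier G" for t
  proof -
    have "t \<in> cocycle_of (x \<otimes> y) \<longleftrightarrow> (t \<in> cocycle_of x) \<noteq> (conj_by (inv x) t \<in> cocycle_of y)"
      unfolding cuv using mem_foldr_flip_by[of u "foldr flip_by v {}" t] that u v
      by (simp add: foldr_flip_by_closed)
    then show ?thesis
      using mem_conj_by_image[OF x that sub(2)] by blast
  qed
  moreover have "sym_diff (cocycle_of x) (conj_by x ` cocycle_of y) \<subseteq> carrier G"
    using x sub by auto
  ultimately show ?thesis
    using sub(3) by blast
qed

lemma conj_by_reflections:
  assumes "g \<in> carrier G" "t \<in> reflections G S"
  shows "conj_by g t \<in> reflections G S"
proof -
  obtain h s where "h \<in> carrier G" "s \<in> S" "t = conj_by h s"
    using assms by (auto simp: reflections_def conj_set_conv)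
  then have "g \<otimes> h \<in> carrier G" "conj_by g t = conj_by (g \<otimes> h) s" "s \<in> S"
    using assms by (simp_all add: conj_by_mult)
  then show ?thesis
    unfolding reflections_def conj_set_conv by blast
qed

lemma reflection_cocycle_of: "reflection_cocycle G S cocycle_of"
  unfolding reflection_cocycle_def conj_set_conv
proof (intro conjI ballI Pi_I PowI)
  have S: "r \<in> reflections G S" if "r \<in> S" for r
    using that unfolding reflections_def conj_set_conv
    by (intro UN_I[of \<one>] image_eqI[of _ _ r]) auto
  fix x assume "x \<in> carrier G"
  then obtain ws where ws: "set ws \<subseteq> S" "wprod ws = x"
    using ex_word by blast
  have "foldr flip_by ws {} \<subseteq> reflections G S"
    using ws(1) by (induction ws) (auto simp: flip_by_def S intro: conj_by_reflections)
  then show "cocycle_of x \<subseteq> reflections G S"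
    using cocycle_of_wprod[OF ws(1)] ws by simp
next
  fix r assume "r \<in> S"
  then show "cocycle_of r = {r}"
    using cocycle_of_wprod[of "[r]"] by (simp add: flip_by_def)
qed (rule cocycle_of_mult)

sublocale reflection_cocycle_group G S cocycle_of
  by unfold_locales (rule reflection_cocycle_of)

section \<open>Descents in infinite dihedral subgroups\<close>

lemma distinct_adj_reduced:
  "\<lbrakk>set ws \<subseteq> S; distinct (inversions ws)\<rbrakk> \<Longrightarrow> distinct_adj ws"
proof (induction ws)
  case (Cons r ws)
  then have "distinct_adj ws" "r \<notin> set (inversions ws)"
    using distinct_inversions_Cons[of r ws] by auto
  then show ?case by (cases ws) auto
qed simp

text \<open>If \<open>s\<close> were an inversion, \<open>s # u\<close> and \<open>u @ [b]\<close>
  would have the same product. Both words alternate, but they start with different letters, so they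
  send \<open>1\<close> to opposite sides.\<close>

lemma dihedral_descent:
  assumes S: "a \<in> S" "s \<in> S" "a \<noteq> s" "m a s = \<infinity>"
    and es: "set es \<subseteq> {a, s}" "distinct (inversions es)" "es \<noteq> []" "hd es = a"
  shows "s \<notin> set (inversions es)"
proof
  assume "s \<in> set (inversions es)"
  moreover have esS: "set es \<subseteq> S" using S es by auto
  ultimately obtain u b v where u: "es = u @ b # v" "s = conj_by (wprod u) b"
    using mem_inversions_iff by blast
  have uS: "set u \<subseteq> S" "b \<in> S" using esS u by auto
  have "s \<otimes> wprod u = wprod u \<otimes> b"
    using conj_by_eq_iff[of "wprod u" b s] u uS S by simp
  then have "wprod (s # u) = wprod (u @ [b])"
    using uS by (simp add: wprod_append)
  then have eq: "foldr (line_action a s) (s # u) 1 = foldr (line_action a s) (u @ [b]) 1"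
  proof (rule foldr_wprod_eq[where X = UNIV, rotated 2])
    \<comment> \<open>A commuting pair is never \<open>a\<close> and \<open>s\<close>, so one of the
      two letters fixes the line.\<close>
    fix r q and n :: int assume "r \<in> S" "q \<in> S" "m r q = 2"
    moreover have "m s a = \<infinity>"
      using S matrix by (metis right_angled_coxeter_matrix_def)
    ultimately show "line_action a s r (line_action a s q n) = line_action a s q (line_action a s r n)"
      using S by (auto simp: line_action_def)
  qed (use uS S in \<open>auto simp: line_action_def\<close>)
  \<comment> \<open>For empty \<open>u\<close>, the letter \<open>b\<close> would be both
    \<open>s\<close> and the head \<open>a\<close>.\<close>
  have "u \<noteq> []"
    using u es S uS by auto
  then have hd: "hd u = a" "hd (u @ [b]) = a" using es u by auto
  have "distinct_adj ((u @ [b]) @ v)"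
    using distinct_adj_reduced[OF esS es(2)] u by simp
  then have adj: "distinct_adj (u @ [b])" "distinct_adj u"
    by blast+
  have "foldr (line_action a s) (u @ [b]) 1 < 0"
    using line_action_ping_pong[of "u @ [b]" a s] es u adj hd S by auto
  moreover have "foldr (line_action a s) (s # u) 1 > 2"
    using line_action_ping_pong[of "s # u" a s] es u adj hd S by (auto simp: distinct_adj_Cons)
  ultimately show False using eq by simp
qed

lemma not_both_descents:
  assumes S: "a \<in> S" "s \<in> S" "a \<noteq> s" "m a s = \<infinity>"
    and x: "x \<in> carrier G" "a \<in> cocycle_of x"
  shows "s \<notin> cocycle_of x"
proof
  assume sx: "s \<in> cocycle_of x"
  \<comment> \<open>Write \<open>x = e y\<close> with \<open>y\<close> minimal in the coset \<open>\<langle>a, s\<rangle> x\<close>; no reflection in \<open>\<langle>a, s\<rangle>\<close> lies in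
    the inversion set of \<open>y\<close>, so both descents of \<open>x\<close> are descents of \<open>e\<close>.\<close>
  let ?P = "\<lambda>ds. set ds \<subseteq> {a, s}"
  obtain ds where ds: "?P ds"
    and min: "\<And>es. ?P es \<Longrightarrow>
      card (cocycle_of (wprod ds \<otimes> x)) \<le> card (cocycle_of (wprod es \<otimes> x))"
    using ex_has_least_nat[of ?P "[]" "\<lambda>ds. card (cocycle_of (wprod ds \<otimes> x))"] by auto
  define y where "y = wprod ds \<otimes> x"
  have dsS: "set ds \<subseteq> S" using ds S by auto
  have y: "y \<in> carrier G" using dsS x by (simp add: y_def)
  \<comment> \<open>Such an inversion would allow a letter of a reduced word for \<open>y\<close> to
    be deleted by multiplying with \<open>wprod ts\<close>, giving a smaller element of the same
    coset.\<close>
  have no: "wprod ts \<notin> cocycle_of y" if ts: "?P ts" for ts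
  proof
    assume t: "wprod ts \<in> cocycle_of y"
    have tsS: "set ts \<subseteq> S" using ts S by auto
    obtain ws where ws: "set ws \<subseteq> S" "wprod ws = y" "distinct (inversions ws)"
      "cocycle_of y = set (inversions ws)"
      using ex_reduced_N[OF y] by blast
    then obtain u b v where u: "ws = u @ b # v" "wprod ts = conj_by (wprod u) b"
      using t mem_inversions_iff by metis
    have uS: "set u \<subseteq> S" "b \<in> S" "set v \<subseteq> S" using ws u by auto
    have "wprod ts \<otimes> wprod u = wprod u \<otimes> b"
      using conj_by_eq_iff[of "wprod u" b "wprod ts"] u uS tsS by simp
    then have "wprod ts \<otimes> wprod u \<otimes> (b \<otimes> wprod v) = wprod u \<otimes> b \<otimes> (b \<otimes> wprod v)"
      by simp
    then have "wprod ts \<otimes> y = wprod (u @ v)"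
      using uS tsS ws(2) u(1) by (auto simp: wprod_append m_assoc involution_cancel)
    then have "wprod (ts @ ds) \<otimes> x = wprod (u @ v)"
      using tsS dsS x by (simp add: y_def wprod_append m_assoc)
    then have "card (cocycle_of y) \<le> card (cocycle_of (wprod (u @ v)))"
      using min[of "ts @ ds"] ts ds by (simp add: y_def)
    also have "\<dots> \<le> card (set (inversions (u @ v)))"
      using uS N_wprod_subset[of "u @ v"] by (intro card_mono) auto
    also have "\<dots> \<le> length (u @ v)"
      using card_length[of "inversions (u @ v)"] by simp
    also have "\<dots> < length ws"
      using u by simp
    also have "\<dots> = card (cocycle_of y)"
      using ws distinct_card[of "inversions ws"] by simp
    finally show False by simp
  qed
  define e where "e = wprod (rev ds)"
  have e: "e \<in> carrier G" "inv e = wprod ds" "x = e \<otimes> y"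
    using dsS x by (simp_all add: e_def y_def wprod_rev flip: m_assoc)
  \<comment> \<open>The conjugate of \<open>r\<close> by \<open>inv e\<close> stays in the dihedral
    subgroup and so misses the inversions of \<open>y\<close>; the cocycle identity then places
    \<open>r\<close> in those of \<open>e\<close>.\<close>
  have "r \<in> cocycle_of e" if r: "r \<in> {a, s}" "r \<in> cocycle_of x" for r
  proof -
    have rS: "r \<in> S" using r S by auto
    have "conj_by (inv e) r = wprod (ds @ [r] @ rev ds)"
      using e(1,2) dsS rS by (simp add: conj_by_def wprod_append wprod_rev m_assoc)
    then have "conj_by (inv e) r \<notin> cocycle_of y"
      using no[of "ds @ [r] @ rev ds"] ds r by auto
    then show ?thesis
      using mem_N_mult[of e y r] e y rS r by simp
  qed
  then have ase: "a \<in> cocycle_of e" "s \<in> cocycle_of e" using x sx by auto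
  obtain es where es: "set es \<subseteq> {a, s}" "wprod es = e" "distinct (inversions es)"
    using ex_reduced_subset[of "rev ds"] dsS ds unfolding e_def by auto
  moreover have "cocycle_of e = set (inversions es)"
    using N_wprod[of es] es S by auto
  ultimately have "a \<in> set (inversions es)" "s \<in> set (inversions es)" "es \<noteq> []"
    using ase by auto
  moreover have "hd es \<in> {a, s}"
    using es(1) \<open>es \<noteq> []\<close> hd_in_set by blast
  moreover have "m s a = \<infinity>"
    using S matrix by (metis right_angled_coxeter_matrix_def)
  \<comment> \<open>Whichever of the two letters \<open>es\<close> starts with, the other cannot be
    an inversion.\<close>
  ultimately show False
    using dihedral_descent[of a s es] dihedral_descent[of s a es] S es by auto
qed

lemma commuting_descents: "commuting_descents G S cocycle_of"
proof
  fix a s x assume "a \<in> S" "s \<in> S" "x \<in> carrier G" "a \<in> cocycle_of x" "s \<in> cocycle_of x"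
  then have "a = s \<or> m a s = 2"
    using not_both_descents matrix unfolding right_angled_coxeter_matrix_def by metis
  then show "a \<otimes> s = s \<otimes> a"
    using m_eq_2_commute \<open>a \<in> S\<close> \<open>s \<in> S\<close> by auto
qed

lemma reflection_system: "reflection_system G S"
  unfolding reflection_system_def
proof (intro conjI ballI)
  fix r assume r: "r \<in> S"
  then have "cocycle_of r \<noteq> cocycle_of \<one>" by (simp add: N_S)
  then show "r \<noteq> \<one>" by auto
qed (use is_group S_subset square_one generate_S in auto)

end

theorem theorem1p5:
  fixes W :: "('a, 'b) monoid_scheme" and S :: "'a set"
  assumes "group W" and "S \<subseteq> carrier W"
  shows "right_angled_coxeter_system W S \<longleftrightarrow>
    reflection_system W S \<and>
    (\<exists>N. reflection_cocycle W S N \<and> meet_intersection_condition W N)"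
proof
  interpret group W by fact
  assume "right_angled_coxeter_system W S"
  then obtain m where m: "right_angled_coxeter_matrix S m"
    and iso: "\<exists>\<phi>\<in>iso (presented_group S (coxeter_relators S m)) W.
      \<forall>s\<in>S. \<phi> (word_class S (coxeter_relators S m) [(s, True)]) = s"
    unfolding right_angled_coxeter_system_def by blast
  interpret right_angled_coxeter W S m
    using m iso iso_presented_group_iff[OF assms(2)] assms(2) by unfold_locales auto
  show "reflection_system W S \<and>
      (\<exists>N. reflection_cocycle W S N \<and> meet_intersection_condition W N)"
    using reflection_system reflection_cocycle_of
      commuting_descents.meet_intersection[OF commuting_descents] by blast
next
  assume rhs: "reflection_system W S \<and>
    (\<exists>N. reflection_cocycle W S N \<and> meet_intersection_condition W N)"
  then obtain N where N: "reflection_cocycle W S N" "meet_intersection_condition W N"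
    by blast
  interpret group W by fact
  interpret reflection_cocycle_group W S N
    using rhs N(1) by unfold_locales (auto simp: reflection_system_def)
  interpret commuting_descents W S N
    using meet_descents_commute[OF N(2)] by unfold_locales
  show "right_angled_coxeter_system W S"
    by (rule right_angled_coxeter_system)
qed

end
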